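(* Let $\varepsilon > 0$ be fixed. For all real $x \geq 1$, all integers $q \geq 1$ with $q \leq x$, and every bijection $\gamma$ of $(\mathbb{Z}/q\mathbb{Z})^{\times}$ onto itself, we have $$T_{\gamma}(x;q) - \frac{1}{\varphi(q)} \left( \sum_{\substack{1 \leq n \leq x \\ \gcd(n,q)=1}} |\mu(n)| \right)^2 \ll x^{\varepsilon} \left( x^{1/2} q^{1/2} + \frac{x}{q^{1/2}} \right),$$ uniformly in $\gamma$.
   Context: Here $\mu$ is the Möbius function, $\varphi$ is Euler's totient function, and for a bijection $\gamma$ of the set $(\mathbb{Z}/q\mathbb{Z})^{\times}$ (not assumed to be a group homomorphism), $$T_{\gamma}(x;q) = \sum_{\substack{1 \leq n_1, n_2 \leq x \\ \gcd(n_1 n_2, q) = 1 \\ n_1 \equiv \gamma(n_2) \ (\mathrm{mod}\ q)}} |\mu(n_1)| |\mu(n_2)|,$$ the sum being over pairs of integers $(n_1,n_2)$, where $\gamma(n_2)$ denotes the image under $\gamma$ of the residue class of $n_2$ modulo $q$. The notation $A \ll B$ means that $|A| \leq C B$ for some constant $C > 0$ depending only on $\varepsilon$ (in particular, independent of $x$, $q$ and $\gamma$). *)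

theory Defs
  imports
    Complex_Main
    "HOL-Computational_Algebra.Squarefree"
    "HOL-Number_Theory.Number_Theory"
    "HOL-Algebra.IntRing"
begin

definition moebius_mu :: "nat \<Rightarrow> int" where
  "moebius_mu n = (if squarefree n then (-1) ^ card (prime_factors n) else 0)"

(* The ring Z/qZ is ZFact (int q); its elements are cosets, i.e. sets of integers, and
   ZMod (int q) a is the class of a.  This choice also covers q = 1, where ZFact 1 is the
   zero ring and has exactly one unit (residue_ring 1 is degenerate: it has no units).
   Only the values of \<gamma> on Units (ZFact (int q)) matter, since n2 is coprime to q. *)
definition T_gamma :: "(int set \<Rightarrow> int set) \<Rightarrow> real \<Rightarrow> nat \<Rightarrow> real" where
  "T_gamma \<gamma> x q =
     (\<Sum>(n1, n2) \<in> {(n1, n2). 1 \<le> n1 \<and> real n1 \<le> x \<and> 1 \<le> n2 \<and> real n2 \<le> x \<and>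
                        gcd (n1 * n2) q = 1 \<and>
                        ZMod (int q) (int n1) = \<gamma> (ZMod (int q) (int n2))}.
        real_of_int (\<bar>moebius_mu n1\<bar> * \<bar>moebius_mu n2\<bar>))"

end

theory Submission
  imports Defs "HOL-Analysis.Convex"
begin

text \<open>
  Let S(a) be the number of squarefree n up to x in the class a modulo q. By the Cauchy-Schwarz
  inequality the left-hand side is at most twice the variance of S over the reduced classes, which
  may be taken around any constant. Write S(a) as the sum over d, prime to q, of \<open>\<mu>(d)\<close> times
  the number of m up to x/d\<open>\<^sup>2\<close> with m d\<open>\<^sup>2\<close> congruent to a, and cut d into dyadic blocks of size P.
  The variance of a block is bounded in two ways: for P\<open>\<^sup>2\<close> > x/\<open>\<surd>q\<close> by its second moment, and for
  smaller P by Parseval's identity on Z/qZ and the geometric series bound. Both reduce to counting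
  k1, k2 up to K and d1, d2 up to D with k1 d2\<open>\<^sup>2\<close> congruent to k2 d1\<open>\<^sup>2\<close> modulo q. For primitive
  pairs, fixing the k's or fixing the d's gives, up to the divisor function of q, D\<open>\<^sup>2\<close>K\<open>\<^sup>2\<close>/q plus
  min(D\<open>\<^sup>2\<close>, K\<open>\<^sup>2\<close>), which is at most DK, so that only the diagonal order DK remains.
\<close>

text \<open>For small d the mean has to be removed before estimating: the second moment bound of a
  block contains \<open>x^2 / (P^2 q)\<close>, far above the target when P = 1 and q is well below
  x. Parseval discards exactly this part, the zero frequency, and pays \<open>P^2\<close> instead.
  The two meet at \<open>P^2 = x / sqrt q\<close>, which explains both the threshold and the term
  \<open>x / sqrt q\<close>. The diagonal solutions contribute \<open>x / P\<close> or, through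
  Parseval, \<open>min (x / P) (P q)\<close>, up to constants; this gives the term
  \<open>sqrt (x q)\<close>. Both routes lead to one congruence because of a duality. The geometric
  sum over m at frequency h is large only when \<open>h d^2 mod q\<close> is small, and these small
  residues then take the place that the cofactors m have in the second moment. The mean that
  Parseval removes runs over all q classes, not over the reduced ones. The variance is therefore
  needed around an arbitrary centre, and the centre finally used is the sum of the block
  means.\<close>

subsection \<open>Counting solutions of quadratic congruences\<close>

text \<open>The fractions u/v of distinct points differ by at least q/D\<open>\<^sup>2\<close>.\<close>

lemma primitive_pairs_card_le:
  fixes S :: "(nat \<times> nat) set"
  assumes q: "q > 0"
    and S: "S \<subseteq> {(u, v). u \<in> {1..D} \<and> v \<in> {1..D} \<and> coprime u v}"
    and cong: "\<And>u v u' v'. (u, v) \<in> S \<Longrightarrow> (u', v') \<in> S \<Longrightarrow> [u * v' = u' * v] (mod q)"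
  shows "real (card S) \<le> 2 * (real D ^ 2 / real q + 1)"
proof -
  \<comment> \<open>With \<open>u \<le> v\<close> the slopes \<open>u/v\<close> lie in (0, 1], so a
    spacing of \<open>q/D^2\<close> leaves room for at most \<open>D^2/q + 1\<close> of them. The
    other half is reached by swapping coordinates.\<close>
  have half: "real (card A) \<le> real D ^ 2 / real q + 1"
    if A: "A \<subseteq> {(u, v). u \<in> {1..D} \<and> v \<in> {1..D} \<and> coprime u v \<and> u \<le> v}"
      and A_cong: "\<And>u v u' v'. (u, v) \<in> A \<Longrightarrow> (u', v') \<in> A \<Longrightarrow> [u * v' = u' * v] (mod q)"
    for A :: "(nat \<times> nat) set"
  proof -
    \<comment> \<open>The slope measured in units of the spacing: distinct slopes have
      \<open>t\<close> at least 1 apart, so rounding down separates them.\<close>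
    define t where "t = (\<lambda>(u::nat, v::nat). real u * real D ^ 2 / (real v * real q))"
    define f where "f = (\<lambda>p. nat \<lfloor>t p\<rfloor>)"
    have gap: "t (u, v) \<ge> t (u', v') + 1"
      if "(u, v) \<in> A" "(u', v') \<in> A" "u * v' > u' * v" for u v u' v'
    proof -
      have r: "1 \<le> v" "v \<le> D" "1 \<le> v'" "v' \<le> D" using A that by auto
      have "[u * v' = u' * v] (mod q)" using A_cong that by blast
      then have "q dvd u * v' - u' * v"
        using that(3) by (metis cong_altdef_nat cong_sym less_imp_le_nat)
      then have "u * v' \<ge> u' * v + q"
        using that(3) by (auto dest!: dvd_imp_le)
      then have 1: "real u * real v' \<ge> real u' * real v + real q"
        by (metis of_nat_add of_nat_le_iff of_nat_mult)
      have "real v * real v' \<le> real D ^ 2"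
        unfolding power2_eq_square using r by (intro mult_mono) auto
      then have "(real u' * real v + real q) * real D ^ 2 \<ge> real u' * real v * real D ^ 2 + real q * (real v * real v')"
        by (simp add: distrib_right mult_left_mono)
      also have "(real u' * real v + real q) * real D ^ 2 \<le> (real u * real v') * real D ^ 2"
        using 1 by (intro mult_right_mono) auto
      finally have "real u' * real v * real D ^ 2 + real q * (real v * real v') \<le> real u * real v' * real D ^ 2" .
      then have "(real u' * real v * real D ^ 2 + real q * (real v * real v')) / (real v * real v' * real q)
          \<le> real u * real v' * real D ^ 2 / (real v * real v' * real q)"
        by (intro divide_right_mono) auto
      moreover have "t (u', v') + 1 = (real u' * real v * real D ^ 2 + real q * (real v * real v')) / (real v * real v' * real q)"
        using r q by (simp add: t_def field_simps)
      moreover have "t (u, v) = real u * real v' * real D ^ 2 / (real v * real v' * real q)"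
        using r q by (simp add: t_def field_simps)
      ultimately show ?thesis by simp
    qed
    have "inj_on f A"
    proof (rule inj_onI)
      fix p p' assume p: "p \<in> A" "p' \<in> A" "f p = f p'"
      obtain u v u' v' where [simp]: "p = (u, v)" "p' = (u', v')" by (cases p, cases p') auto
      have r: "1 \<le> v" "1 \<le> v'" "coprime u v" "coprime u' v'" using A p by auto
      have fl: "\<lfloor>t p\<rfloor> = \<lfloor>t p'\<rfloor>"
      proof -
        have "t p \<ge> 0" "t p' \<ge> 0" by (auto simp: t_def)
        then show ?thesis using p(3) by (simp add: f_def eq_nat_nat_iff)
      qed
      have "u * v' = u' * v"
      proof (rule ccontr)
        assume "u * v' \<noteq> u' * v"
        then consider "u * v' > u' * v" | "u' * v > u * v'" by linarith
        then have "t p \<ge> t p' + 1 \<or> t p' \<ge> t p + 1"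
          using gap[of u v u' v'] gap[of u' v' u v] p by cases auto
        then show False using fl by linarith
      qed
      then have "u dvd u' * v" "u' dvd u * v'"
        by (metis dvd_triv_left, metis dvd_triv_left)
      then have "u dvd u'" "u' dvd u"
        using r by (simp_all add: coprime_dvd_mult_left_iff)
      then have "u = u'" by (rule dvd_antisym)
      moreover have "u > 0" using A p by auto
      ultimately show "p = p'" using \<open>u * v' = u' * v\<close> by auto
    qed
    moreover have "f ` A \<subseteq> {.. nat \<lfloor>real D ^ 2 / real q\<rfloor>}"
    proof safe
      fix u v assume "(u, v) \<in> A"
      then have r: "1 \<le> v" "u \<le> v" using A by auto
      then have "t (u, v) \<le> real D ^ 2 / real q"
        using q by (simp add: t_def field_simps mult_right_mono)
      then show "f (u, v) \<le> nat \<lfloor>real D ^ 2 / real q\<rfloor>"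
        unfolding f_def by (intro nat_mono floor_mono)
    qed
    ultimately have "card A \<le> card {.. nat \<lfloor>real D ^ 2 / real q\<rfloor>}"
      by (meson card_inj_on_le finite_atMost)
    also have "\<dots> = nat \<lfloor>real D ^ 2 / real q\<rfloor> + 1" by simp
    finally have "real (card A) \<le> real (nat \<lfloor>real D ^ 2 / real q\<rfloor>) + 1"
      by (metis of_nat_1 of_nat_add of_nat_mono)
    also have "real (nat \<lfloor>real D ^ 2 / real q\<rfloor>) \<le> real D ^ 2 / real q" 
      by (intro of_nat_floor) simp
    finally show ?thesis by simp
  qed
  define A B where "A = {(u, v) \<in> S. u \<le> v}" and "B = prod.swap ` {(u, v) \<in> S. v \<le> u}"
  have "finite S" by (rule finite_subset[OF S], rule finite_subset[of _ "{1..D} \<times> {1..D}"]) auto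
  then have fin: "finite A" "finite {(u, v) \<in> S. v \<le> u}" 
    unfolding A_def by (rule finite_subset[rotated], blast)+
  have 1: "real (card A) \<le> real D ^ 2 / real q + 1"
    by (rule half) (use S cong in \<open>auto simp: A_def\<close>)
  have 2: "real (card B) \<le> real D ^ 2 / real q + 1"
  proof (rule half)
    show "B \<subseteq> {(u, v). u \<in> {1..D} \<and> v \<in> {1..D} \<and> coprime u v \<and> u \<le> v}"
      using S by (auto simp: B_def coprime_commute)
    fix u v u' v' assume "(u, v) \<in> B" "(u', v') \<in> B"
    then have "(v, u) \<in> S" "(v', u') \<in> S" by (auto simp: B_def)
    from cong[OF this] show "[u * v' = u' * v] (mod q)"
      by (simp add: mult.commute cong_sym_eq)
  qed
  have "A \<union> {(u, v) \<in> S. v \<le> u} = S" by (auto simp: A_def)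
  then have "card S \<le> card A + card {(u, v) \<in> S. v \<le> u}"
    using card_Un_le[of A "{(u, v) \<in> S. v \<le> u}"] by argo
  also have "card {(u, v) \<in> S. v \<le> u} = card B"
    unfolding B_def by (intro card_image[symmetric] inj_on_subset[OF inj_swap]) auto
  finally have "real (card S) \<le> real (card A) + real (card B)" by linarith
  then show ?thesis using 1 2 by simp
qed

text \<open>
  Fix a point (u0, v0). Since q divides (u v0 - u0 v)(u v0 + u0 v), the value k of
  gcd (u v0 - u0 v, q) determines u/v modulo lcm (k, q/k), which is at least q/2.
\<close>

lemma cong_square_pairs_card_le:
  fixes S :: "(nat \<times> nat) set"
  assumes q: "q > 0"
    and S: "S \<subseteq> {(u, v). u \<in> {1..D} \<and> v \<in> {1..D} \<and> coprime u v \<and> coprime u q \<and> coprime v q}"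
    and cong: "\<And>u v u' v'. (u, v) \<in> S \<Longrightarrow> (u', v') \<in> S \<Longrightarrow> [(u * v')\<^sup>2 = (u' * v)\<^sup>2] (mod q)"
  shows "real (card S) \<le> 4 * real (card {g. g dvd q}) * (real D ^ 2 / real q + 1)"
proof (cases "S = {}")
  case True
  then show ?thesis by simp
next
  case False
  then obtain u0 v0 where 0: "(u0, v0) \<in> S" by auto
  define g where "g = (\<lambda>(u, v). nat (gcd (int u * int v0 - int u0 * int v) (int q)))"
  have cop0: "coprime u0 q" "coprime v0 q" using S 0 by auto
  have fibre: "real (card {p \<in> S. g p = k}) \<le> 4 * (real D ^ 2 / real q + 1)" if k: "k dvd q" for k
  proof -
    define A where "A = {p \<in> S. g p = k}"
    define l where "l = lcm k (q div k)"
    obtain k' where k': "q = k * k'" using k by auto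
    have k'q: "k' = q div k" using k' q by auto
    have cong1: "[int u * int v0 = int u0 * int v] (mod int k)"
      and cong2: "[int u * int v0 = - (int u0 * int v)] (mod int k')"
      if "(u, v) \<in> A" for u v
    proof -
      have uS: "(u, v) \<in> S" and gk: "gcd (int u * int v0 - int u0 * int v) (int q) = int k"
        using that by (auto simp: A_def g_def)
      have "int k dvd int u * int v0 - int u0 * int v" by (metis gk gcd_dvd1)
      then show "[int u * int v0 = int u0 * int v] (mod int k)" by (simp add: cong_iff_dvd_diff)
      have "[(u * v0)\<^sup>2 = (u0 * v)\<^sup>2] (mod q)" using cong uS 0 by blast
      then have "[int ((u * v0)\<^sup>2) = int ((u0 * v)\<^sup>2)] (mod int q)" by (simp only: cong_int_iff)
      then have "int q dvd (int u * int v0)\<^sup>2 - (int u0 * int v)\<^sup>2" by (simp add: cong_iff_dvd_diff)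
      also have "(int u * int v0)\<^sup>2 - (int u0 * int v)\<^sup>2 = (int u * int v0 - int u0 * int v) * (int u * int v0 + int u0 * int v)"
        by (simp add: power2_eq_square algebra_simps)
      finally have d: "int q dvd (int u * int v0 - int u0 * int v) * (int u * int v0 + int u0 * int v)" .
      \<comment> \<open>Since k is the whole gcd, the cofactor \<open>w\<close> is coprime to
        \<open>k' = q/k\<close>; hence all of \<open>k'\<close> has to divide the sum.\<close>
      obtain w where w: "int u * int v0 - int u0 * int v = int k * w"
        using \<open>int k dvd _\<close> by auto
      have kpos: "k > 0" using q k' by auto
      have "gcd (int k * w) (int k * int k') = int k * gcd w (int k')"
        by (simp add: gcd_mult_left abs_mult)
      then have "int k * gcd w (int k') = int k"
        using gk w k' by simp
      then have cw: "coprime w (int k')" using kpos by (simp add: coprime_iff_gcd_eq_1)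
      have "int k' dvd w * (int u * int v0 + int u0 * int v)"
        using d w k' kpos by (simp add: mult.assoc)
      then have "int k' dvd (int u * int v0 + int u0 * int v)"
        using cw by (metis coprime_commute coprime_dvd_mult_right_iff)
      then show "[int u * int v0 = - (int u0 * int v)] (mod int k')" by (simp add: cong_iff_dvd_diff)
    qed
    \<comment> \<open>Modulo \<open>k'\<close> every point has slope \<open>-u0/v0\<close>.
      Comparing two points removes the sign, so the congruences modulo \<open>k\<close> and
      \<open>k'\<close> merge into one modulo their lcm.\<close>
    have congl: "[u * v' = u' * v] (mod l)" if "(u, v) \<in> A" "(u', v') \<in> A" for u v u' v'
    proof -
      have cc: "coprime (int v0) (int k)" "coprime (int v0) (int k')" 
        using cop0 k' by auto
      have "[(int u * int v') * int v0 = int u0 * int v * int v'] (mod int k)"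
        using cong_scalar_right[OF cong1[OF that(1)], of "int v'"] by (simp only: mult_ac)
      moreover have "[(int u' * int v) * int v0 = int u0 * int v * int v'] (mod int k)"
        using cong_scalar_right[OF cong1[OF that(2)], of "int v"] by (simp only: mult_ac)
      ultimately have "[(int u * int v') * int v0 = (int u' * int v) * int v0] (mod int k)"
        by (blast intro: cong_trans cong_sym)
      then have 1: "[int u * int v' = int u' * int v] (mod int k)"
        by (simp only: cong_mult_rcancel[OF cc(1)])
      have "[(int u * int v') * int v0 = - (int u0 * int v * int v')] (mod int k')"
        using cong_scalar_right[OF cong2[OF that(1)], of "int v'"] by (simp only: mult_ac mult_minus_left mult_minus_right)
      moreover have "[(int u' * int v) * int v0 = - (int u0 * int v * int v')] (mod int k')"
        using cong_scalar_right[OF cong2[OF that(2)], of "int v"] by (simp only: mult_ac mult_minus_left mult_minus_right)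
      ultimately have "[(int u * int v') * int v0 = (int u' * int v) * int v0] (mod int k')"
        by (blast intro: cong_trans cong_sym)
      then have 2: "[int u * int v' = int u' * int v] (mod int k')"
        by (simp only: cong_mult_rcancel[OF cc(2)])
      have "[int u * int v' = int u' * int v] (mod int l)"
        using 1 2 unfolding l_def k'q[symmetric] cong_iff_dvd_diff lcm_int_int_eq[symmetric]
        by (rule lcm_least)
      then show ?thesis unfolding of_nat_mult[symmetric] cong_int_iff .
    qed
    show ?thesis
    proof (cases "A = {}")
      case True
      then have "{p \<in> S. g p = k} = {}" by (simp only: A_def)
      then show ?thesis by (simp only:) simp
    next
      case False
      then obtain u v where uv: "(u, v) \<in> A" by auto
      then have "coprime v q" using S by (auto simp: A_def)
      have kpos: "k > 0" "k' > 0" using q k' by auto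
      then have lpos: "l > 0" unfolding l_def k'q[symmetric] by (simp add: lcm_pos_nat)
      \<comment> \<open>A common divisor of \<open>k\<close> and \<open>k'\<close> divides sum and
        difference, hence \<open>2 u0 v\<close>; being coprime to \<open>u0 v\<close> it divides 2.
        This gives \<open>q \<le> 2 l\<close> and turns the factor 2 of the linear count into
        4.\<close>
      define t where "t = gcd k k'"
      have lt: "l * t = q" 
        unfolding l_def t_def k'q[symmetric] using prod_gcd_lcm_nat[of k k'] k' by (simp only: mult.commute)
      have "int t dvd int k" "int t dvd int k'" by (simp_all add: t_def)
      then have "int t dvd int u * int v0 - int u0 * int v" "int t dvd int u * int v0 + int u0 * int v"
        using cong1[OF uv] cong2[OF uv] unfolding cong_iff_dvd_diff diff_minus_eq_add
        by (blast intro: dvd_trans)+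
      then have "int t dvd (int u * int v0 + int u0 * int v) - (int u * int v0 - int u0 * int v)"
        by (rule dvd_diff[rotated])
      then have "int t dvd int (2 * (u0 * v))" by (simp add: algebra_simps)
      then have "t dvd 2 * (u0 * v)" by (simp only: int_dvd_int_iff)
      moreover have "t dvd q" using lt by (metis dvd_triv_right)
      then have "coprime t (u0 * v)" 
        using coprime_divisors[of t q "u0 * v" "u0 * v"] cop0 \<open>coprime v q\<close>
        by (simp add: coprime_commute)
      ultimately have "t dvd 2" by (simp add: coprime_dvd_mult_left_iff)
      then have "t \<le> 2" by (rule dvd_imp_le) simp
      then have "q \<le> 2 * l" using lt mult_le_mono2[of t 2 l] by (simp only: mult.commute)
      then have ql: "1 / real l \<le> 2 / real q" using q lpos by (simp add: field_simps)
      have "real (card A) \<le> 2 * (real D ^ 2 / real l + 1)"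
        by (rule primitive_pairs_card_le[OF lpos _ congl]) (use S in \<open>auto simp: A_def\<close>)
      also have "real D ^ 2 / real l \<le> 2 * (real D ^ 2 / real q)"
        using mult_left_mono[OF ql, of "real D ^ 2"] by (simp add: mult.commute)
      finally show ?thesis by (simp add: A_def)
    qed
  qed
  have gS: "g p dvd q" for p
  proof -
    have "int (g p) dvd int q" by (cases p) (simp add: g_def)
    then show ?thesis by simp
  qed
  have "(\<Union>k\<in>{g. g dvd q}. {p \<in> S. g p = k}) = S" using gS by auto
  then have "card S \<le> (\<Sum>k\<in>{g. g dvd q}. card {p \<in> S. g p = k})"
    using card_UN_le[of "{g. g dvd q}" "\<lambda>k. {p \<in> S. g p = k}"] q by simp
  then have "real (card S) \<le> (\<Sum>k\<in>{g. g dvd q}. real (card {p \<in> S. g p = k}))"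
    by (simp only: of_nat_sum[symmetric] of_nat_le_iff)
  also have "\<dots> \<le> (\<Sum>k\<in>{g. g dvd q}. 4 * (real D ^ 2 / real q + 1))"
    by (intro sum_mono fibre) auto
  finally show ?thesis by (simp add: algebra_simps)
qed

section \<open>Counting quadruples\<close>

text \<open>These are the solutions of \<open>k1/d1^2 = k2/d2^2\<close> in Z/qZ. Only the d's are
  prime to q: the k's will be cofactors m or residues of \<open>h d^2\<close>, and both may share
  factors with q.\<close>

definition cong_quads :: "nat \<Rightarrow> nat \<Rightarrow> nat \<Rightarrow> (nat \<times> nat \<times> nat \<times> nat) set" where
  "cong_quads D K q = {(k1, k2, d1, d2). k1 \<in> {1..K} \<and> k2 \<in> {1..K} \<and> d1 \<in> {1..D} \<and> d2 \<in> {1..D} \<and>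
     coprime d1 q \<and> coprime d2 q \<and> [k1 * d2\<^sup>2 = k2 * d1\<^sup>2] (mod q)}"

lemma finite_cong_quads [simp]: "finite (cong_quads D K q)"
  by (rule finite_subset[of _ "{1..K} \<times> {1..K} \<times> {1..D} \<times> {1..D}"]) (auto simp: cong_quads_def)

lemma card_fibration_le:
  fixes B :: real
  assumes fin: "finite I" "finite A" and sub: "h ` A \<subseteq> I"
    and fib: "\<And>i. i \<in> I \<Longrightarrow> real (card {a \<in> A. h a = i}) \<le> B"
  shows "real (card A) \<le> real (card I) * B"
proof -
  have "real (card A) = (\<Sum>a\<in>A. 1)" by simp
  also have "\<dots> = (\<Sum>i\<in>I. \<Sum>a | a \<in> A \<and> h a = i. 1)"
    using fin sub by (intro sum.group[symmetric]) auto
  also have "\<dots> \<le> (\<Sum>i\<in>I. B)"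
    using fib by (intro sum_mono) simp
  finally show ?thesis by simp
qed

lemma primitive_cong_quads_card_le:
  fixes D K q :: nat
  assumes q: "q > 0"
  defines "P \<equiv> {(k1, k2, d1, d2) \<in> cong_quads D K q. coprime k1 k2 \<and> coprime d1 d2}"
  shows "real (card P) \<le> 4 * real (card {g. g dvd q}) * (real D ^ 2 * real K ^ 2 / real q + real D * real K)"
proof -
  define \<tau> where "\<tau> = real (card {g. g dvd q})"
  have "finite {g. g dvd q}" using q by simp
  then have \<tau>: "\<tau> \<ge> 1"
    unfolding \<tau>_def using card_mono[of "{g. g dvd q}" "{1}"] by simp
  have finP: "finite P" by (rule finite_subset[OF _ finite_cong_quads[of D K q]]) (auto simp: P_def)
  \<comment> \<open>Primitivity forces this: a common divisor of \<open>k2\<close> and q divides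
    \<open>k1 d2^2\<close>, hence \<open>k1\<close>, and so equals 1. It is what allows
    \<open>k2\<close> to be cancelled below.\<close>
  have cop_k: "coprime k2 q" if "(k1, k2, d1, d2) \<in> P" for k1 k2 d1 d2
  proof -
    have c: "[k1 * d2\<^sup>2 = k2 * d1\<^sup>2] (mod q)" "coprime d2 q" "coprime k1 k2"
      using that by (auto simp: P_def cong_quads_def)
    define g where "g = gcd k2 q"
    have "g dvd q" "g dvd k2" by (simp_all add: g_def)
    have "[k1 * d2\<^sup>2 = k2 * d1\<^sup>2] (mod g)" 
      using c(1) \<open>g dvd q\<close> by (rule cong_dvd_modulus_nat)
    then have "g dvd k1 * d2\<^sup>2"
      using \<open>g dvd k2\<close> cong_dvd_iff[of "k1 * d2\<^sup>2" "k2 * d1\<^sup>2" g] by simp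
    moreover have "coprime g (d2\<^sup>2)"
      using c(2) \<open>g dvd q\<close> coprime_divisors[of g q "d2\<^sup>2" "d2\<^sup>2"] by (simp add: coprime_commute)
    ultimately have "g dvd k1" by (simp add: coprime_dvd_mult_left_iff)
    then have "g = 1" using \<open>g dvd k2\<close> coprime_common_divisor[OF c(3), of g] by simp
    then show ?thesis by (simp only: g_def coprime_iff_gcd_eq_1)
  qed
  \<comment> \<open>Fixed k's prescribe only the square of \<open>d1/d2\<close> modulo q; the count
    for squares applies and costs the divisor function.\<close>
  have 1: "real (card P) \<le> real K ^ 2 * (4 * \<tau> * (real D ^ 2 / real q + 1))"
  proof -
    have "real (card P) \<le> real (card ({1..K} \<times> {1..K})) * (4 * \<tau> * (real D ^ 2 / real q + 1))"
    proof (rule card_fibration_le[where h = "\<lambda>(k1, k2, d1, d2). (k1, k2)"])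
      fix i assume "i \<in> {1..K} \<times> {1..K}"
      obtain k1 k2 where i: "i = (k1, k2)" by (cases i) auto
      define S where "S = {(d1, d2). (k1, k2, d1, d2) \<in> P}"
      have "{a \<in> P. (case a of (k1, k2, d1, d2) \<Rightarrow> (k1, k2)) = i} = (\<lambda>(d1, d2). (k1, k2, d1, d2)) ` S"
        by (auto simp: S_def i)
      moreover have "inj_on (\<lambda>(d1, d2). (k1, k2, d1, d2)) S" by (auto simp: inj_on_def)
      ultimately have "card {a \<in> P. (case a of (k1, k2, d1, d2) \<Rightarrow> (k1, k2)) = i} = card S"
        by (simp only: card_image)
      moreover have "real (card S) \<le> 4 * real (card {g. g dvd q}) * (real D ^ 2 / real q + 1)"
      proof (rule cong_square_pairs_card_le[OF q])
        show "S \<subseteq> {(u, v). u \<in> {1..D} \<and> v \<in> {1..D} \<and> coprime u v \<and> coprime u q \<and> coprime v q}"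
          by (auto simp: S_def P_def cong_quads_def)
        fix u v u' v' assume uv: "(u, v) \<in> S" "(u', v') \<in> S"
        then have 1: "[k1 * v\<^sup>2 = k2 * u\<^sup>2] (mod q)" and 2: "[k1 * v'\<^sup>2 = k2 * u'\<^sup>2] (mod q)"
          by (simp_all add: S_def P_def cong_quads_def)
        have k2: "coprime k2 q" using uv(1) unfolding S_def by (auto intro: cop_k)
        have "[k2 * (u * v')\<^sup>2 = k1 * v\<^sup>2 * v'\<^sup>2] (mod q)"
          using cong_sym[OF cong_scalar_right[OF 1, of "v'\<^sup>2"]] by (simp only: power_mult_distrib mult_ac)
        moreover have "[k2 * (u' * v)\<^sup>2 = k1 * v\<^sup>2 * v'\<^sup>2] (mod q)"
          using cong_sym[OF cong_scalar_right[OF 2, of "v\<^sup>2"]] by (simp only: power_mult_distrib mult_ac)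
        ultimately have "[k2 * (u * v')\<^sup>2 = k2 * (u' * v)\<^sup>2] (mod q)"
          by (blast intro: cong_trans cong_sym)
        then show "[(u * v')\<^sup>2 = (u' * v)\<^sup>2] (mod q)"
          by (simp only: cong_mult_lcancel_nat[OF k2])
      qed
      ultimately show "real (card {a \<in> P. (case a of (k1, k2, d1, d2) \<Rightarrow> (k1, k2)) = i}) \<le> 4 * \<tau> * (real D ^ 2 / real q + 1)"
        by (simp add: \<tau>_def)
    qed (use finP in \<open>auto simp: P_def cong_quads_def\<close>)
    then show ?thesis by (simp add: power2_eq_square)
  qed
  \<comment> \<open>Fixed d's prescribe \<open>k1/k2\<close> itself, so the linear count suffices
    and no divisor function appears.\<close>
  have 2: "real (card P) \<le> real D ^ 2 * (2 * (real K ^ 2 / real q + 1))"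
  proof -
    have "real (card P) \<le> real (card ({1..D} \<times> {1..D})) * (2 * (real K ^ 2 / real q + 1))"
    proof (rule card_fibration_le[where h = "\<lambda>(k1, k2, d1, d2). (d1, d2)"])
      fix i assume "i \<in> {1..D} \<times> {1..D}"
      obtain d1 d2 where i: "i = (d1, d2)" by (cases i) auto
      define S where "S = {(k1, k2). (k1, k2, d1, d2) \<in> P}"
      have "{a \<in> P. (case a of (k1, k2, d1, d2) \<Rightarrow> (d1, d2)) = i} = (\<lambda>(k1, k2). (k1, k2, d1, d2)) ` S"
        by (auto simp: S_def i)
      moreover have "inj_on (\<lambda>(k1, k2). (k1, k2, d1, d2)) S" by (auto simp: inj_on_def)
      ultimately have "card {a \<in> P. (case a of (k1, k2, d1, d2) \<Rightarrow> (d1, d2)) = i} = card S"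
        by (simp only: card_image)
      moreover have "real (card S) \<le> 2 * (real K ^ 2 / real q + 1)"
      proof (rule primitive_pairs_card_le[OF q])
        show "S \<subseteq> {(u, v). u \<in> {1..K} \<and> v \<in> {1..K} \<and> coprime u v}"
          by (auto simp: S_def P_def cong_quads_def)
        fix u v u' v' assume uv: "(u, v) \<in> S" "(u', v') \<in> S"
        then have 1: "[u * d2\<^sup>2 = v * d1\<^sup>2] (mod q)" and 2: "[u' * d2\<^sup>2 = v' * d1\<^sup>2] (mod q)" and d1: "coprime d1 q"
          by (auto simp: S_def P_def cong_quads_def)
        have d1: "coprime (d1\<^sup>2) q" using d1 by simp
        have "[d1\<^sup>2 * (u * v') = u * u' * d2\<^sup>2] (mod q)"
          using cong_sym[OF cong_scalar_right[OF 2, of u]] by (simp only: mult_ac)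
        moreover have "[d1\<^sup>2 * (u' * v) = u * u' * d2\<^sup>2] (mod q)"
          using cong_sym[OF cong_scalar_right[OF 1, of u']] by (simp only: mult_ac)
        ultimately have "[d1\<^sup>2 * (u * v') = d1\<^sup>2 * (u' * v)] (mod q)"
          by (blast intro: cong_trans cong_sym)
        then show "[u * v' = u' * v] (mod q)"
          by (simp only: cong_mult_lcancel_nat[OF d1])
      qed
      ultimately show "real (card {a \<in> P. (case a of (k1, k2, d1, d2) \<Rightarrow> (d1, d2)) = i}) \<le> 2 * (real K ^ 2 / real q + 1)"
        by simp
    qed (use finP in \<open>auto simp: P_def cong_quads_def\<close>)
    then show ?thesis by (simp add: power2_eq_square)
  qed
  show ?thesis
  proof (cases "K \<le> D")
    case True
    then have "real K * real K \<le> real D * real K" by (intro mult_right_mono) auto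
    then have "4 * \<tau> * (real D ^ 2 * real K ^ 2 / real q + real K * real K) \<le> 4 * \<tau> * (real D ^ 2 * real K ^ 2 / real q + real D * real K)"
      using \<tau> by (intro mult_left_mono add_left_mono) auto
    then show ?thesis using 1 unfolding \<tau>_def[symmetric] by (simp add: algebra_simps power2_eq_square)
  next
    case False
    then have "real D * real D \<le> real D * real K" by (intro mult_left_mono) auto
    then have "2 * (real D ^ 2 * real K ^ 2 / real q + real D * real D) \<le> 2 * (real D ^ 2 * real K ^ 2 / real q + real D * real K)"
      using False by simp
    also have "\<dots> \<le> 4 * \<tau> * (real D ^ 2 * real K ^ 2 / real q + real D * real K)"
      using \<tau> by (intro mult_right_mono add_nonneg_nonneg) auto
    finally show ?thesis using 2 unfolding \<tau>_def[symmetric] by (simp add: algebra_simps power2_eq_square)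
  qed
qed

text \<open>Dividing out \<open>e = gcd d1 d2\<close> is free, as e is prime to q. But
  \<open>f = gcd k1 k2\<close> cancels only at the price of the smaller modulus
  \<open>q div gcd f q\<close>, which is at least \<open>q/f\<close>. The shorter ranges of
  \<open>k1\<close> and \<open>k2\<close> gain \<open>1/f^2\<close>, so a weight \<open>1/f\<close>
  survives, and summing over e and f produces the two harmonic sums.\<close>

lemma cong_quads_card_le:
  fixes D K q :: nat
  assumes q: "q > 0"
  shows "real (card (cong_quads D K q)) \<le> 4 * real (card {g. g dvd q}) * (\<Sum>e=1..D. 1 / real e) * (\<Sum>f=1..K. 1 / real f)
           * (real D ^ 2 * real K ^ 2 / real q + real D * real K)"
proof -
  define P where "P = (\<lambda>D K q. {(k1, k2, d1, d2) \<in> cong_quads D K q. coprime k1 k2 \<and> coprime d1 d2})"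
  define m where "m = (\<lambda>e f (k1, k2, d1, d2). (f * k1, f * k2, e * d1, e * d2) :: nat \<times> nat \<times> nat \<times> nat)"
  define Q where "Q = (\<lambda>(e, f). m e f ` P (D div e) (K div f) (q div gcd f q))"
  define \<tau> where "\<tau> = real (card {g. g dvd q})"
  have finP: "finite (P D K q)" for D K q
    by (rule finite_subset[OF _ finite_cong_quads[of D K q]]) (auto simp: P_def)
  have "cong_quads D K q \<subseteq> (\<Union>p\<in>{1..D} \<times> {1..K}. Q p)"
  proof
    fix x assume x: "x \<in> cong_quads D K q"
    obtain k1 k2 d1 d2 where xeq: "x = (k1, k2, d1, d2)" by (cases x) auto
    have r: "k1 \<in> {1..K}" "k2 \<in> {1..K}" "d1 \<in> {1..D}" "d2 \<in> {1..D}" "coprime d1 q" "coprime d2 q"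
      and c: "[k1 * d2\<^sup>2 = k2 * d1\<^sup>2] (mod q)"
      using x by (auto simp: cong_quads_def xeq)
    define e f where "e = gcd d1 d2" and "f = gcd k1 k2"
    have pos: "e > 0" "f > 0" using r by (auto simp: e_def f_def)
    have "e \<le> d1" "f \<le> k1" using r by (auto simp: e_def f_def intro!: dvd_imp_le)
    then have le: "e \<le> D" "f \<le> K" using r by auto
    obtain a1 a2 where a: "d1 = e * a1" "d2 = e * a2" "coprime a1 a2"
      using gcd_coprime_exists[of d1 d2] pos unfolding e_def by (metis mult.commute neq0_conv)
    obtain b1 b2 where b: "k1 = f * b1" "k2 = f * b2" "coprime b1 b2"
      using gcd_coprime_exists[of k1 k2] pos unfolding f_def by (metis mult.commute neq0_conv)
    obtain f' q' where fq: "q = q' * gcd f q" "f = f' * gcd f q" "coprime f' q'"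
      using gcd_coprime_exists[of f q] pos by (metis gcd_pos_nat neq0_conv)
    define g where "g = gcd f q"
    have g: "q = q' * g" "f = f' * g" "g > 0" using fq pos by (auto simp: g_def)
    have q': "q div gcd f q = q'" using g unfolding g_def[symmetric] by simp
    have "coprime e q" using r(5) a by simp
    have "int q dvd int k1 * (int d2)\<^sup>2 - int k2 * (int d1)\<^sup>2"
      using c unfolding cong_int_iff[symmetric] by (simp add: cong_iff_dvd_diff)
    also have "int k1 * (int d2)\<^sup>2 - int k2 * (int d1)\<^sup>2 = (int e)\<^sup>2 * (int f * (int b1 * (int a2)\<^sup>2 - int b2 * (int a1)\<^sup>2))"
      unfolding a b by (simp add: algebra_simps power_mult_distrib)
    finally have "int q dvd int f * (int b1 * (int a2)\<^sup>2 - int b2 * (int a1)\<^sup>2)"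
      using \<open>coprime e q\<close> by (subst (asm) coprime_dvd_mult_right_iff) (auto simp: coprime_commute)
    then have "int g * int q' dvd int g * (int f' * (int b1 * (int a2)\<^sup>2 - int b2 * (int a1)\<^sup>2))"
      by (simp only: g of_nat_mult mult_ac)
    then have "int q' dvd int f' * (int b1 * (int a2)\<^sup>2 - int b2 * (int a1)\<^sup>2)"
      using g(3) by simp
    then have "int q' dvd int b1 * (int a2)\<^sup>2 - int b2 * (int a1)\<^sup>2"
      using fq(3) by (subst (asm) coprime_dvd_mult_right_iff) (auto simp: coprime_commute)
    then have "[int (b1 * a2\<^sup>2) = int (b2 * a1\<^sup>2)] (mod int q')" by (simp add: cong_iff_dvd_diff)
    then have c': "[b1 * a2\<^sup>2 = b2 * a1\<^sup>2] (mod q')" by (simp only: cong_int_iff)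
    have cp: "coprime a1 q'" "coprime a2 q'" using r(5,6) unfolding a g(1) by auto
    have bd: "a1 \<in> {1..D div e}" "a2 \<in> {1..D div e}" "b1 \<in> {1..K div f}" "b2 \<in> {1..K div f}"
      using r pos unfolding a b by (auto simp: less_eq_div_iff_mult_less_eq mult.commute)
    have "(b1, b2, a1, a2) \<in> P (D div e) (K div f) (q div gcd f q)"
      using bd cp c' a b unfolding P_def q' by (auto simp: cong_quads_def)
    moreover have "x = m e f (b1, b2, a1, a2)" by (simp add: m_def xeq a b)
    ultimately have "x \<in> Q (e, f)" by (auto simp: Q_def)
    then show "x \<in> (\<Union>p\<in>{1..D} \<times> {1..K}. Q p)" using pos le by force
  qed
  then have "card (cong_quads D K q) \<le> card (\<Union>p\<in>{1..D} \<times> {1..K}. Q p)"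
    by (intro card_mono) (auto simp: Q_def finP)
  also have "\<dots> \<le> (\<Sum>p\<in>{1..D} \<times> {1..K}. card (Q p))" by (rule card_UN_le) simp
  finally have "real (card (cong_quads D K q)) \<le> (\<Sum>p\<in>{1..D} \<times> {1..K}. real (card (Q p)))"
    by (simp only: of_nat_sum[symmetric] of_nat_le_iff)
  also have "\<dots> \<le> (\<Sum>(e, f)\<in>{1..D} \<times> {1..K}. 4 * \<tau> * (real D ^ 2 * real K ^ 2 / real q + real D * real K) * (1 / real e) * (1 / real f))"
  proof (rule sum_mono, clarsimp)
    fix e f :: nat assume ef: "Suc 0 \<le> e" "Suc 0 \<le> f" "e \<le> D" "f \<le> K"
    define q' where "q' = q div gcd f q"
    have "q' dvd q" unfolding q'_def by (rule dvdI[where k = "gcd f q"]) simp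
    have q': "q' > 0" using q \<open>q' dvd q\<close> by (rule dvd_pos_nat)
    have "card {g. g dvd q'} \<le> card {g. g dvd q}"
      using q \<open>q' dvd q\<close> by (intro card_mono) (auto intro: dvd_trans)
    then have \<tau>': "real (card {g. g dvd q'}) \<le> \<tau>" by (simp add: \<tau>_def)
    have "q = q' * gcd f q" by (simp add: q'_def)
    moreover have "q' * gcd f q \<le> q' * f" using ef by (intro mult_left_mono gcd_le1_nat) auto
    ultimately have "q \<le> q' * f" by linarith
    then have "real q \<le> real q' * real f" by (simp only: of_nat_mult[symmetric] of_nat_le_iff)
    then have qf: "1 / real q' \<le> real f / real q" using q q' by (simp add: field_simps)
    have "real (D div e * e) \<le> real D" "real (K div f * f) \<le> real K"
      by (simp_all only: of_nat_le_iff div_times_less_eq_dividend)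
    then have De: "real (D div e) \<le> real D / real e" and Kf: "real (K div f) \<le> real K / real f"
      using ef by (simp_all add: pos_le_divide_eq)
    have "real (card (Q (e, f))) \<le> real (card (P (D div e) (K div f) q'))"
      unfolding Q_def by (auto intro!: card_image_le finP simp: q'_def)
    also have "\<dots> \<le> 4 * real (card {g. g dvd q'}) * (real (D div e) ^ 2 * real (K div f) ^ 2 / real q' + real (D div e) * real (K div f))"
      unfolding P_def by (rule primitive_cong_quads_card_le[OF q'])
    also have "\<dots> \<le> 4 * \<tau> * ((real D / real e) ^ 2 * (real K / real f) ^ 2 * (real f / real q) + (real D / real e) * (real K / real f))"
    proof (intro mult_mono add_mono)
      have "real (D div e) ^ 2 * real (K div f) ^ 2 * (1 / real q') \<le> (real D / real e) ^ 2 * (real K / real f) ^ 2 * (real f / real q)"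
        using De Kf qf by (intro mult_mono power_mono) auto
      then show "real (D div e) ^ 2 * real (K div f) ^ 2 / real q' \<le> (real D / real e) ^ 2 * (real K / real f) ^ 2 * (real f / real q)"
        by simp
    qed (use De Kf \<tau>' in auto)
    also have "(real D / real e) ^ 2 * (real K / real f) ^ 2 * (real f / real q) = (real D ^ 2 * real K ^ 2 / real q) * (1 / real e ^ 2 * (1 / real f))"
      using ef q by (simp add: field_simps power2_eq_square)
    \<comment> \<open>\<open>1/e^2\<close> is weakened to \<open>1/e\<close> so that the main term
      and the diagonal term carry the same weight.\<close>
    also have "\<dots> \<le> (real D ^ 2 * real K ^ 2 / real q) * (1 / real e * (1 / real f))"
      using ef by (intro mult_left_mono mult_right_mono) (auto simp: field_simps power2_eq_square)
    finally have "real (card (Q (e, f))) \<le> 4 * \<tau> * ((real D ^ 2 * real K ^ 2 / real q) * (1 / real e * (1 / real f)) + (real D / real e) * (real K / real f))"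
      by (simp add: \<tau>_def mult_left_mono)
    also have "\<dots> = 4 * \<tau> * (real D ^ 2 * real K ^ 2 / real q + real D * real K) * (1 / real e) * (1 / real f)"
      by (simp add: algebra_simps)
    finally show "real (card (Q (e, f))) \<le> 4 * \<tau> * (real D ^ 2 * real K ^ 2 / real q + real D * real K) / (real e * real f)" by simp
  qed
  also have "\<dots> = (4 * \<tau> * (real D ^ 2 * real K ^ 2 / real q + real D * real K)) * ((\<Sum>e=1..D. 1 / real e) * (\<Sum>f=1..K. 1 / real f))"
    by (subst sum_product, subst sum.cartesian_product, subst sum_distrib_left, intro sum.cong) auto
  finally show ?thesis by (simp only: \<tau>_def mult_ac)
qed

subsection \<open>Finite Fourier analysis of progressions\<close>

text \<open>The frequency is kept as an exponent, so orthogonality is the geometric sum of the q-th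
  root of unity \<open>e a * cnj (e b)\<close>, which is 1 only for \<open>a = b\<close> because the
  \<open>e a\<close> are distinct.\<close>

lemma finite_Parseval:
  fixes F :: "nat \<Rightarrow> real" and q :: nat
  assumes q: "q > 0"
  defines "G \<equiv> \<lambda>h. \<Sum>a<q. of_real (F a) * cis (2 * pi * real a / real q) ^ h"
  shows "(\<Sum>h<q. (norm (G h))\<^sup>2) = real q * (\<Sum>a<q. (F a)\<^sup>2)"
proof -
  define e where "e = (\<lambda>a::nat. cis (2 * pi * real a / real q))"
  have orth: "(\<Sum>h<q. (e a * cnj (e b)) ^ h) = (if a = b then of_nat q else 0)" if "a < q" "b < q" for a b
  proof -
    have 1: "e b * cnj (e b) = 1" for b
      unfolding complex_norm_square[symmetric] by (simp add: e_def)
    have p: "e b ^ q = 1" for b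
      using q by (simp add: e_def DeMoivre)
    show ?thesis
    proof (cases "a = b")
      case False
      have "inj_on e {..<q}"
        using bij_betw_roots_unity[OF q] unfolding e_def by (rule bij_betw_imp_inj_on)
      then have "e a \<noteq> e b" using False that by (auto dest: inj_onD)
      have "e a * cnj (e b) * e b = e a" using 1[of b] by (simp add: mult_ac)
      then have "e a * cnj (e b) \<noteq> 1" using \<open>e a \<noteq> e b\<close> by force
      moreover have "(e a * cnj (e b)) ^ q = 1"
        using p[of a] p[of b] by (simp add: power_mult_distrib flip: complex_cnj_power)
      ultimately show ?thesis using False by (simp add: geometric_sum)
    qed (simp add: 1)
  qed
  have G_e: "G h = (\<Sum>a<q. of_real (F a) * e a ^ h)" for h
    by (simp only: G_def e_def)
  have "complex_of_real ((norm (G h))\<^sup>2) = (\<Sum>a<q. \<Sum>b<q. of_real (F a * F b) * (e a * cnj (e b)) ^ h)" for h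
    unfolding complex_norm_square G_e cnj_sum sum_product
    by (intro sum.cong) (simp_all add: power_mult_distrib mult_ac)
  then have "complex_of_real (\<Sum>h<q. (norm (G h))\<^sup>2) = (\<Sum>h<q. \<Sum>a<q. \<Sum>b<q. of_real (F a * F b) * (e a * cnj (e b)) ^ h)"
    by (simp only: of_real_sum)
  also have "\<dots> = (\<Sum>a<q. \<Sum>h<q. \<Sum>b<q. of_real (F a * F b) * (e a * cnj (e b)) ^ h)"
    by (rule sum.swap)
  also have "\<dots> = (\<Sum>a<q. \<Sum>b<q. \<Sum>h<q. of_real (F a * F b) * (e a * cnj (e b)) ^ h)"
    by (intro sum.cong refl sum.swap)
  also have "\<dots> = (\<Sum>a<q. \<Sum>b<q. of_real (F a * F b) * (if a = b then of_nat q else 0))"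
    by (intro sum.cong refl) (simp add: orth flip: sum_distrib_left)
  also have "\<dots> = (\<Sum>a<q. of_real (F a * F a) * of_nat q)"
    by (intro sum.cong refl) (simp add: if_distrib sum.delta cong: if_cong)
  also have "\<dots> = complex_of_real (real q * (\<Sum>a<q. (F a)\<^sup>2))"
    by (simp add: power2_eq_square sum_distrib_left mult_ac)
  finally show ?thesis by (simp only: of_real_eq_iff)
qed

lemma sum_square_deviation_eq:
  fixes F :: "nat \<Rightarrow> real" and q :: nat
  assumes q: "q > 0"
  shows "(\<Sum>a<q. (F a - (\<Sum>a<q. F a) / real q)\<^sup>2) = (\<Sum>a<q. (F a)\<^sup>2) - (\<Sum>a<q. F a)\<^sup>2 / real q"
proof -
  define S where "S = (\<Sum>a<q. F a)"
  have "(\<Sum>a<q. (F a - S / real q)\<^sup>2) = (\<Sum>a<q. (F a)\<^sup>2 - 2 * (S / real q) * F a + (S / real q)\<^sup>2)"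
    by (simp add: power2_diff algebra_simps)
  also have "\<dots> = (\<Sum>a<q. (F a)\<^sup>2) - 2 * (S / real q) * S + real q * (S / real q)\<^sup>2"
    by (simp only: sum.distrib sum_subtractf sum_distrib_left[symmetric] S_def[symmetric]) simp
  also have "\<dots> = (\<Sum>a<q. (F a)\<^sup>2) - S\<^sup>2 / real q"
    using q by (simp add: power2_eq_square)
  finally show ?thesis by (simp only: S_def)
qed

text \<open>Frequency 0 carries the total of F, so Parseval without it measures exactly the
  deviation from the mean.\<close>

lemma finite_variance_eq:
  fixes F :: "nat \<Rightarrow> real" and q :: nat
  assumes q: "q > 0"
  defines "G \<equiv> \<lambda>h. \<Sum>a<q. of_real (F a) * cis (2 * pi * real a / real q) ^ h"
  shows "(\<Sum>a<q. (F a - (\<Sum>a<q. F a) / real q)\<^sup>2) = (\<Sum>h=1..<q. (norm (G h))\<^sup>2) / real q"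
proof -
  define S where "S = (\<Sum>a<q. F a)"
  have "(\<Sum>a<q. (F a - S / real q)\<^sup>2) = (\<Sum>a<q. (F a)\<^sup>2) - S\<^sup>2 / real q"
    unfolding S_def by (rule sum_square_deviation_eq[OF q])
  also have "(\<Sum>a<q. (F a)\<^sup>2) = (\<Sum>h<q. (norm (G h))\<^sup>2) / real q"
    unfolding G_def finite_Parseval[OF q] using q by simp
  also have "(\<Sum>h<q. (norm (G h))\<^sup>2) = (norm (G 0))\<^sup>2 + (\<Sum>h=1..<q. (norm (G h))\<^sup>2)"
    using q by (simp add: lessThan_atLeast0 sum.atLeast_Suc_lessThan)
  also have "(norm (G 0))\<^sup>2 = S\<^sup>2"
  proof -
    have "G 0 = of_real S" by (simp add: G_def S_def)
    then show ?thesis by (simp only: norm_of_real power2_abs)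
  qed
  finally show ?thesis by (simp add: S_def add_divide_distrib)
qed

text \<open>A weak Jordan inequality: up to \<open>pi/3\<close> the derivative is at least 1/2,
  beyond it the sine is. At \<open>x = pi j / q\<close> it reads \<open>sin x \<ge> j / q\<close>,
  which is all that the geometric sums require.\<close>

lemma sin_ge_divide_pi:
  assumes "0 \<le> x" "x \<le> pi / 2"
  shows "x / pi \<le> sin x"
proof (cases "x \<le> pi / 3")
  case True
  show ?thesis
  proof (cases "x = 0")
    case False
    then have "x > 0" using assms by simp
    then obtain z where z: "0 < z" "z < x" "sin x - sin 0 = (x - 0) * cos z"
      using MVT2[of 0 x sin cos] by auto
    have "cos z \<ge> cos (pi / 3)" using z True pi_gt_zero by (intro cos_monotone_0_pi_le) auto
    then have "sin x \<ge> x * (1 / 2)" using z \<open>x > 0\<close> by (simp add: cos_60)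
    moreover have "x / pi \<le> x / 2" using \<open>x > 0\<close> pi_ge_two by (intro divide_left_mono) auto
    ultimately show ?thesis by linarith
  qed simp
next
  case False
  have "sin (pi / 6) \<le> sin x"
    using assms False pi_gt_zero by (intro sin_monotone_2pi_le) auto
  moreover have "x / pi \<le> 1 / 2" using assms pi_gt_zero by (simp add: field_simps)
  ultimately show ?thesis unfolding sin_30 by linarith
qed

lemma norm_one_minus_cis: "norm (1 - cis t) = 2 * \<bar>sin (t / 2)\<bar>"
proof -
  have "(norm (1 - cis t))\<^sup>2 = (1 - cos t)\<^sup>2 + (sin t)\<^sup>2"
    by (simp add: cmod_power2)
  also have "\<dots> = 2 - 2 * cos t"
    using sin_cos_squared_add[of t] by (simp add: power2_diff)
  also have "cos t = 1 - 2 * (sin (t / 2))\<^sup>2"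
    using cos_double_sin[of "t / 2"] by simp
  finally have "(norm (1 - cis t))\<^sup>2 = (2 * \<bar>sin (t / 2)\<bar>)\<^sup>2"
    by (simp add: power_mult_distrib)
  then show ?thesis by (rule power2_eq_imp_eq) auto
qed

text \<open>The usual bound involves the distance from k to the nearest multiple of q. Adding the
  terms for k and for \<open>q - k\<close> covers both sides and makes the second term the
  reflection of the first, so that later only small residues have to be counted.\<close>

lemma norm_geometric_cis_le:
  fixes k q M :: nat
  assumes k: "0 < k" "k < q"
  defines "w \<equiv> cis (2 * pi * real k / real q)"
  shows "norm (\<Sum>m=1..M. w ^ m) \<le> min (real M) (real q / real k) + min (real M) (real q / real (q - k))"
proof -
  have nw: "norm w = 1" by (simp add: w_def)
  have triv: "norm (\<Sum>m=1..M. w ^ m) \<le> real M"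
    using norm_sum[of "\<lambda>m. w ^ m" "{1..M}"] nw by (simp add: norm_power)
  define s where "s = \<bar>sin (pi * real k / real q)\<bar>"
  have n1: "norm (1 - w) = 2 * s"
    unfolding w_def norm_one_minus_cis s_def by simp
  \<comment> \<open>The closed form of the sum gives \<open>2 / (2 s) = 1 / s\<close>. The sine
    bound is applied to whichever of k and \<open>q - k\<close> is at most
    \<open>q/2\<close>.\<close>
  have recip: "s > 0 \<and> 1 / s \<le> real q / real j"
    if j: "0 < j" "pi * real j / real q \<le> pi / 2" "\<bar>sin (pi * real j / real q)\<bar> = s" for j
  proof -
    have "real j / real q > 0" using j(1) k by simp
    moreover have "real j / real q \<le> s"
      using sin_ge_divide_pi[of "pi * real j / real q"] j by auto
    ultimately have "s > 0" "1 / s \<le> 1 / (real j / real q)"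
      by (linarith, intro frac_le) auto
    then show ?thesis by simp
  qed
  have ge: "s > 0 \<and> (1 / s \<le> real q / real k \<or> 1 / s \<le> real q / real (q - k))"
  proof (cases "2 * k \<le> q")
    case True
    then have "pi * real k / real q \<le> pi / 2" using k by (simp add: field_simps)
    then show ?thesis using recip[of k] k by (simp add: s_def)
  next
    case False
    have eq: "pi * real (q - k) / real q = pi - pi * real k / real q"
      using k by (simp add: of_nat_diff field_simps)
    have "2 * real (q - k) \<le> real q" using k False by linarith
    then have "pi * real (q - k) / real q \<le> pi / 2" using k by (simp add: field_simps del: of_nat_diff)
    moreover have "\<bar>sin (pi * real (q - k) / real q)\<bar> = s" unfolding eq s_def by simp
    ultimately show ?thesis using recip[of "q - k"] k by simp
  qed
  have "w \<noteq> 1" using n1 ge by auto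
  have "(\<Sum>m=1..M. w ^ m) = w * (\<Sum>m<M. w ^ m)"
    by (simp add: sum_distrib_left sum.atLeast1_atMost_eq)
  also have "\<dots> = w * ((w ^ M - 1) / (w - 1))"
    using \<open>w \<noteq> 1\<close> by (simp add: geometric_sum)
  finally have "norm (\<Sum>m=1..M. w ^ m) = norm (w ^ M - 1) / norm (1 - w)"
    using nw by (simp add: norm_mult norm_divide norm_minus_commute)
  also have "norm (w ^ M - 1) \<le> 2"
    using norm_triangle_ineq4[of "w ^ M" 1] nw by (simp add: norm_power)
  finally have "norm (\<Sum>m=1..M. w ^ m) \<le> 1 / s"
    using ge n1 by (simp add: divide_right_mono)
  then have "norm (\<Sum>m=1..M. w ^ m) \<le> min (real M) (real q / real k) \<or> norm (\<Sum>m=1..M. w ^ m) \<le> min (real M) (real q / real (q - k))"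
    using triv ge by auto
  moreover have "min (real M) (real q / real k) \<ge> 0" "min (real M) (real q / real (q - k)) \<ge> 0" by auto
  ultimately show ?thesis by (blast intro: add_increasing add_increasing2)
qed

section \<open>Weighted counts of m d^2 in residue classes\<close>

text \<open>With \<open>c\<close> the Moebius function and \<open>M d\<close> the integer part of
  \<open>x/d^2\<close>, this is the contribution to S(a) of the d in A.\<close>

definition progression_weight :: "(nat \<Rightarrow> real) \<Rightarrow> (nat \<Rightarrow> nat) \<Rightarrow> nat set \<Rightarrow> nat \<Rightarrow> nat \<Rightarrow> real" where
  "progression_weight c M A q a = (\<Sum>d\<in>A. c d * real (card {m \<in> {1..M d}. m * d\<^sup>2 mod q = a}))"

lemma sum_card_fibre:
  fixes \<phi> :: "nat \<Rightarrow> 'a::comm_semiring_1"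
  assumes "finite A" "\<And>m. m \<in> A \<Longrightarrow> g m < q"
  shows "(\<Sum>a<q. of_nat (card {m \<in> A. g m = a}) * \<phi> a) = (\<Sum>m\<in>A. \<phi> (g m))"
proof -
  have "(\<Sum>m\<in>A. \<phi> (g m)) = (\<Sum>a<q. \<Sum>m | m \<in> A \<and> g m = a. \<phi> (g m))"
    using assms by (intro sum.group[symmetric]) auto
  also have "\<dots> = (\<Sum>a<q. \<Sum>m | m \<in> A \<and> g m = a. \<phi> a)"
    by (intro sum.cong) auto
  finally show ?thesis by simp
qed

text \<open>Frequency and summation variable change places:
  \<open>e (m d^2)^h = e (h d^2)^m\<close>. The inner sum becomes geometric in m, with its ratio
  determined by the residue of \<open>h d^2\<close>.\<close>

lemma progression_weight_transform:
  fixes q :: nat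
  assumes q: "q > 0" and A: "finite A"
  shows "(\<Sum>a<q. of_real (progression_weight c M A q a) * cis (2 * pi * real a / real q) ^ h)
         = (\<Sum>d\<in>A. of_real (c d) * (\<Sum>m=1..M d. cis (2 * pi * real (h * d\<^sup>2 mod q) / real q) ^ m))"
proof -
  define e where "e = (\<lambda>a::nat. cis (2 * pi * real a / real q))"
  have e_pow: "e a ^ n = e (n * a)" for a n
    by (simp add: e_def DeMoivre mult_ac)
  have e_mod: "e (a mod q) = e a" for a
  proof -
    have "a = a mod q + q * (a div q)" by simp
    then have "real a = real (a mod q) + real q * real (a div q)" by (metis of_nat_add of_nat_mult)
    then have "2 * pi * real a / real q = 2 * pi * real (a mod q) / real q + 2 * pi * real (a div q)"
      using q by (simp add: field_simps)
    then have "e a = e (a mod q) * cis (2 * pi * real (a div q))"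
      unfolding e_def cis_mult by (simp only:)
    then show ?thesis by (simp only: cis_multiple_2pi[OF Ints_of_nat] mult_1_right)
  qed
  have "(\<Sum>a<q. of_real (progression_weight c M A q a) * e a ^ h)
      = (\<Sum>a<q. \<Sum>d\<in>A. of_real (c d) * (of_nat (card {m \<in> {1..M d}. m * d\<^sup>2 mod q = a}) * e a ^ h))"
    by (simp only: progression_weight_def of_real_sum of_real_mult of_real_of_nat_eq sum_distrib_right mult.assoc)
  also have "\<dots> = (\<Sum>d\<in>A. of_real (c d) * (\<Sum>a<q. of_nat (card {m \<in> {1..M d}. m * d\<^sup>2 mod q = a}) * e a ^ h))"
    by (subst sum.swap) (simp add: sum_distrib_left)
  also have "\<dots> = (\<Sum>d\<in>A. of_real (c d) * (\<Sum>m=1..M d. e (m * d\<^sup>2 mod q) ^ h))"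
    using q by (intro sum.cong refl arg_cong2[where f = "(*)"] sum_card_fibre) auto
  also have "\<dots> = (\<Sum>d\<in>A. of_real (c d) * (\<Sum>m=1..M d. e (h * d\<^sup>2 mod q) ^ m))"
  proof (intro sum.cong refl arg_cong2[where f = "(*)"])
    fix d m
    show "e (m * d\<^sup>2 mod q) ^ h = e (h * d\<^sup>2 mod q) ^ m"
      unfolding e_pow by (metis e_mod mod_mult_right_eq mult.left_commute)
  qed
  finally show ?thesis by (simp only: e_def)
qed

lemma progression_weight_sum_squares_le:
  fixes q :: nat
  assumes q: "q > 0" and A: "A \<subseteq> {1..D}" "\<And>d. d \<in> A \<Longrightarrow> coprime d q"
    and c: "\<And>d. d \<in> A \<Longrightarrow> \<bar>c d\<bar> \<le> 1" and M: "\<And>d. d \<in> A \<Longrightarrow> M d \<le> N"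
  shows "(\<Sum>a<q. (progression_weight c M A q a)\<^sup>2) \<le> real (card (cong_quads D N q))"
proof -
  define B where "B = (\<lambda>a. {(d, m). d \<in> A \<and> m \<in> {1..N} \<and> m * d\<^sup>2 mod q = a})"
  have finA: "finite A" using A(1) finite_subset by blast
  have finB: "finite (B a)" for a
    by (rule finite_subset[of _ "A \<times> {1..N}"]) (auto simp: B_def finA)
  have "\<bar>progression_weight c M A q a\<bar> \<le> real (card (B a))" for a
  proof -
    have "\<bar>progression_weight c M A q a\<bar> \<le> (\<Sum>d\<in>A. \<bar>c d\<bar> * real (card {m \<in> {1..M d}. m * d\<^sup>2 mod q = a}))"
      unfolding progression_weight_def by (rule order_trans[OF sum_abs]) (simp add: abs_mult)
    also have "\<dots> \<le> (\<Sum>d\<in>A. 1 * real (card {m \<in> {1..N}. m * d\<^sup>2 mod q = a}))"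
    proof (intro sum_mono mult_mono)
      fix d assume "d \<in> A"
      then show "real (card {m \<in> {1..M d}. m * d\<^sup>2 mod q = a}) \<le> real (card {m \<in> {1..N}. m * d\<^sup>2 mod q = a})"
        using M[of d] by (intro of_nat_mono card_mono) auto
    qed (use c in auto)
    also have "\<dots> = real (card (SIGMA d:A. {m \<in> {1..N}. m * d\<^sup>2 mod q = a}))"
      using finA by (subst card_SigmaI) auto
    also have "(SIGMA d:A. {m \<in> {1..N}. m * d\<^sup>2 mod q = a}) = B a" by (auto simp: B_def)
    finally show ?thesis .
  qed
  then have "(progression_weight c M A q a)\<^sup>2 \<le> (real (card (B a)))\<^sup>2" for a
    by (meson abs_le_square_iff abs_of_nat order_trans abs_ge_self)
  then have "(\<Sum>a<q. (progression_weight c M A q a)\<^sup>2) \<le> (\<Sum>a<q. (real (card (B a)))\<^sup>2)"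
    by (intro sum_mono)
  also have "\<dots> = real (\<Sum>a<q. card (B a \<times> B a))"
    by (simp add: card_cartesian_product power2_eq_square)
  also have "(\<Sum>a<q. card (B a \<times> B a)) = card (SIGMA a:{..<q}. B a \<times> B a)"
    by (subst card_SigmaI) (auto simp: finB)
  also have "\<dots> \<le> card (cong_quads D N q)"
  proof (rule card_inj_on_le)
    \<comment> \<open>The d's are exchanged because pairs in one class satisfy
      \<open>m1 d1^2 = m2 d2^2\<close>, whereas \<open>cong_quads\<close> multiplies each k by the
      square of the opposite d. The class a is recovered from \<open>m1\<close> and
      \<open>d1\<close>.\<close>
    let ?f = "\<lambda>(a::nat, (d1::nat, m1::nat), (d2::nat, m2::nat)). (m1, m2, d2, d1)"
    show "inj_on ?f (SIGMA a:{..<q}. B a \<times> B a)"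
      by (auto simp: inj_on_def B_def)
    show "?f ` (SIGMA a:{..<q}. B a \<times> B a) \<subseteq> cong_quads D N q"
      using A by (auto simp: B_def cong_quads_def cong_def)
  qed simp
  finally show ?thesis by simp
qed

text \<open>Replacing the weight \<open>q/k\<close> by indicators turns the square of a sum over d
  into a count of pairs. The least j with \<open>k \<le> 2^j\<close> has
  \<open>2^j \<le> 2 k\<close>, whence the factor 2.\<close>

lemma min_le_dyadic_sum:
  fixes N q k I :: nat
  assumes k: "0 < k" "k \<le> 2 ^ I"
  shows "min (real N) (real q / real k) \<le> (\<Sum>i\<le>I. min (real N) (2 * real q / 2 ^ i) * of_bool (k \<le> 2 ^ i))"
proof -
  define j where "j = (LEAST i. k \<le> 2 ^ i)"
  have j: "k \<le> 2 ^ j" "j \<le> I"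
    unfolding j_def using k(2) by (rule LeastI, intro Least_le)
  have "2 ^ j \<le> 2 * k"
  proof (cases j)
    case 0
    then show ?thesis using k by simp
  next
    case (Suc i)
    then have "\<not> k \<le> 2 ^ i" unfolding j_def by (intro not_less_Least) simp
    then show ?thesis using Suc by simp
  qed
  then have "2 ^ j \<le> 2 * real k" by (metis of_nat_le_iff of_nat_mult of_nat_numeral of_nat_power)
  then have "real q * 2 ^ j \<le> real q * (2 * real k)" by (rule mult_left_mono) simp
  then have "real q / real k \<le> 2 * real q / 2 ^ j"
    using k by (simp add: field_simps)
  then have "min (real N) (real q / real k) \<le> min (real N) (2 * real q / 2 ^ j) * of_bool (k \<le> 2 ^ j)"
    using j by simp
  also have "\<dots> \<le> (\<Sum>i\<le>I. min (real N) (2 * real q / 2 ^ i) * of_bool (k \<le> 2 ^ i))"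
    using j by (intro member_le_sum) auto
  finally show ?thesis .
qed

text \<open>After Parseval, each dyadic scale asks for pairs d1, d2 for which both residues of
  \<open>h d^2\<close> are at most \<open>2^i\<close>; summed over h these embed into
  \<open>cong_quads\<close>. The factor 4 is 2 from squaring \<open>W h + W (q - h)\<close> times 2
  because both parts have the same sum of squares; \<open>I + 1\<close> is Cauchy-Schwarz over the
  scales.\<close>

lemma progression_weight_variance_le:
  fixes q I :: nat
  assumes q: "q > 0" and A: "A \<subseteq> {1..D}" "\<And>d. d \<in> A \<Longrightarrow> coprime d q"
    and c: "\<And>d. d \<in> A \<Longrightarrow> \<bar>c d\<bar> \<le> 1" and M: "\<And>d. d \<in> A \<Longrightarrow> M d \<le> N" and I: "q \<le> 2 ^ I"
  defines "F \<equiv> progression_weight c M A q"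
  shows "(\<Sum>a<q. (F a - (\<Sum>a<q. F a) / real q)\<^sup>2)
    \<le> 4 * real (I + 1) / real q * (\<Sum>i\<le>I. (min (real N) (2 * real q / 2 ^ i))\<^sup>2 * real (card (cong_quads D (2 ^ i) q)))"
proof -
  have finA: "finite A" using A(1) finite_subset by blast
  define e where "e = (\<lambda>a::nat. cis (2 * pi * real a / real q))"
  define G where "G = (\<lambda>h. \<Sum>a<q. of_real (F a) * e a ^ h)"
  define r where "r = (\<lambda>h d. h * d\<^sup>2 mod q)"
  define W where "W = (\<lambda>h. \<Sum>d\<in>A. min (real N) (real q / real (r h d)))"
  define w where "w = (\<lambda>i. min (real N) (2 * real q / 2 ^ i))"
  \<comment> \<open>As d is prime to q and q does not divide h, the residue never vanishes, so
    division by it is meaningful; reflecting h reflects the residue.\<close>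
  have r: "0 < r h d" "r h d < q" "r (q - h) d = q - r h d" if h: "h \<in> {1..<q}" and d: "d \<in> A" for h d
  proof -
    have "\<not> q dvd h" using h by (auto dest: dvd_imp_le)
    moreover have "coprime q (d\<^sup>2)" using A(2)[OF d] by (simp add: coprime_commute)
    ultimately have "\<not> q dvd h * d\<^sup>2" by (simp add: coprime_dvd_mult_left_iff)
    then show 1: "0 < r h d" unfolding r_def by (simp add: mod_greater_zero_iff_not_dvd)
    show 2: "r h d < q" using q by (simp add: r_def)
    have "(q - h) * d\<^sup>2 + h * d\<^sup>2 = q * d\<^sup>2"
      using h by (metis add_mult_distrib atLeastLessThan_iff le_add_diff_inverse2 less_imp_le)
    then have "(r (q - h) d + r h d) mod q = 0"
      by (simp add: r_def mod_add_eq)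
    moreover have "r (q - h) d + r h d > 0" using 1 by simp
    moreover have "r (q - h) d + r h d < 2 * q" using 2 q by (simp add: r_def add_strict_mono mult_2)
    moreover from calculation(1) obtain k where k: "r (q - h) d + r h d = q * k"
      by (auto simp: mod_eq_0_iff_dvd)
    ultimately have "0 < k" "k < 2" by (auto intro: Nat.gr0I)
    then have "k = 1" by linarith
    then have "r (q - h) d + r h d = q" using k by simp
    then show "r (q - h) d = q - r h d" by linarith
  qed
  have normG: "norm (G h) \<le> W h + W (q - h)" if h: "h \<in> {1..<q}" for h
  proof -
    have "G h = (\<Sum>d\<in>A. of_real (c d) * (\<Sum>m=1..M d. e (r h d) ^ m))"
      unfolding G_def F_def e_def r_def by (rule progression_weight_transform[OF q finA])
    then have "norm (G h) \<le> (\<Sum>d\<in>A. \<bar>c d\<bar> * norm (\<Sum>m=1..M d. e (r h d) ^ m))"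
      using norm_sum[of "\<lambda>d. of_real (c d) * (\<Sum>m=1..M d. e (r h d) ^ m)" A] by (simp add: norm_mult)
    also have "\<dots> \<le> (\<Sum>d\<in>A. 1 * (min (real N) (real q / real (r h d)) + min (real N) (real q / real (r (q - h) d))))"
    proof (intro sum_mono mult_mono)
      fix d assume d: "d \<in> A"
      have "norm (\<Sum>m=1..M d. e (r h d) ^ m)
          \<le> min (real (M d)) (real q / real (r h d)) + min (real (M d)) (real q / real (q - r h d))"
        unfolding e_def by (rule norm_geometric_cis_le) (use r[OF h d] in auto)
      also have "\<dots> \<le> min (real N) (real q / real (r h d)) + min (real N) (real q / real (q - r h d))"
        using M[OF d] by (intro add_mono min.mono) auto
      finally show "norm (\<Sum>m=1..M d. e (r h d) ^ m)
          \<le> min (real N) (real q / real (r h d)) + min (real N) (real q / real (r (q - h) d))"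
        by (simp only: r[OF h d])
    qed (use c in auto)
    finally show ?thesis by (simp add: W_def sum.distrib)
  qed
  have W2: "(\<Sum>h=1..<q. (W h)\<^sup>2) \<le> real (I + 1) * (\<Sum>i\<le>I. (w i)\<^sup>2 * real (card (cong_quads D (2 ^ i) q)))"
  proof -
    define B where "B = (\<lambda>i h. {d \<in> A. r h d \<le> 2 ^ i})"
    have finB: "finite (B i h)" for i h by (simp add: B_def finA)
    have "W h \<le> (\<Sum>i\<le>I. w i * real (card (B i h)))" if h: "h \<in> {1..<q}" for h
    proof -
      have "W h \<le> (\<Sum>d\<in>A. \<Sum>i\<le>I. w i * of_bool (r h d \<le> 2 ^ i))"
        unfolding W_def w_def
      proof (intro sum_mono min_le_dyadic_sum)
        fix d assume d: "d \<in> A"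
        show "0 < r h d" by (rule r(1)[OF h d])
        show "r h d \<le> 2 ^ I" using r(2)[OF h d] I by linarith
      qed
      also have "\<dots> = (\<Sum>i\<le>I. w i * (\<Sum>d\<in>A. of_bool (r h d \<le> 2 ^ i)))"
        by (subst sum.swap) (simp add: sum_distrib_left)
      also have "\<dots> = (\<Sum>i\<le>I. w i * real (card (B i h)))"
        by (simp add: B_def finA sum_of_bool_eq Int_def)
      finally show ?thesis .
    qed
    moreover have "W h \<ge> 0" for h unfolding W_def by (intro sum_nonneg) auto
    ultimately have "(W h)\<^sup>2 \<le> (\<Sum>i\<le>I. w i * real (card (B i h)))\<^sup>2" if h: "h \<in> {1..<q}" for h
      using h by (intro power_mono) auto
    also have "(\<Sum>i\<le>I. w i * real (card (B i h)))\<^sup>2 \<le> real (I + 1) * (\<Sum>i\<le>I. (w i)\<^sup>2 * (real (card (B i h)))\<^sup>2)" for h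
      using sum_squared_le_sum_of_squares[of "\<lambda>i. w i * real (card (B i h))" "{..I}"]
      by (simp add: power_mult_distrib mult.commute)
    finally have "(\<Sum>h=1..<q. (W h)\<^sup>2) \<le> (\<Sum>h=1..<q. real (I + 1) * (\<Sum>i\<le>I. (w i)\<^sup>2 * (real (card (B i h)))\<^sup>2))"
      by (intro sum_mono)
    also have "\<dots> = real (I + 1) * (\<Sum>i\<le>I. (w i)\<^sup>2 * (\<Sum>h=1..<q. (real (card (B i h)))\<^sup>2))"
      by (simp only: sum_distrib_left) (subst sum.swap, rule refl)
    also have "\<dots> \<le> real (I + 1) * (\<Sum>i\<le>I. (w i)\<^sup>2 * real (card (cong_quads D (2 ^ i) q)))"
    proof (intro mult_left_mono sum_mono)
      fix i
      have "(\<Sum>h=1..<q. (real (card (B i h)))\<^sup>2) = real (\<Sum>h=1..<q. card (B i h \<times> B i h))"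
        by (simp add: card_cartesian_product power2_eq_square)
      also have "(\<Sum>h=1..<q. card (B i h \<times> B i h)) = card (SIGMA h:{1..<q}. B i h \<times> B i h)"
        by (subst card_SigmaI) (auto simp: finB)
      also have "\<dots> \<le> card (cong_quads D (2 ^ i) q)"
      proof (rule card_inj_on_le)
        let ?f = "\<lambda>(h, d1, d2). (r h d1, r h d2, d1, d2)"
        \<comment> \<open>The quadruple does not record h, but h is determined by the residue of
          \<open>h d1^2\<close>, since \<open>d1\<close> is invertible modulo q.\<close>
        show "inj_on ?f (SIGMA h:{1..<q}. B i h \<times> B i h)"
        proof (rule inj_onI, clarsimp)
          fix h h' d1 d2 assume *: "r h d1 = r h' d1" "h < q" "h' < q" "d1 \<in> B i h"
          then have "[h * d1\<^sup>2 = h' * d1\<^sup>2] (mod q)" "coprime (d1\<^sup>2) q"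
            using A(2)[of d1] by (simp_all add: r_def cong_def B_def)
          then have "[h = h'] (mod q)" by (simp add: cong_mult_rcancel_nat)
          then show "h = h'" using * by (simp add: cong_def)
        qed
        show "?f ` (SIGMA h:{1..<q}. B i h \<times> B i h) \<subseteq> cong_quads D (2 ^ i) q"
        proof clarsimp
          fix h d1 d2 assume h: "Suc 0 \<le> h" "h < q" and d: "d1 \<in> B i h" "d2 \<in> B i h"
          have dA: "d1 \<in> A" "d2 \<in> A" using d by (auto simp: B_def)
          have "[r h d1 * d2\<^sup>2 = h * d1\<^sup>2 * d2\<^sup>2] (mod q)" "[r h d2 * d1\<^sup>2 = h * d2\<^sup>2 * d1\<^sup>2] (mod q)"
            unfolding r_def by (intro cong_scalar_right; simp add: cong_def)+
          then have "[r h d1 * d2\<^sup>2 = r h d2 * d1\<^sup>2] (mod q)"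
            by (simp add: cong_def mult_ac)
          then show "(r h d1, r h d2, d1, d2) \<in> cong_quads D (2 ^ i) q"
            using r(1)[of h d1] r(1)[of h d2] h d dA A by (auto simp: cong_quads_def B_def)
        qed
      qed simp
      finally show "(\<Sum>h=1..<q. (real (card (B i h)))\<^sup>2) \<le> real (card (cong_quads D (2 ^ i) q))" by simp
    qed auto
    finally show ?thesis .
  qed
  have "(\<Sum>a<q. (F a - (\<Sum>a<q. F a) / real q)\<^sup>2) = (\<Sum>h=1..<q. (norm (G h))\<^sup>2) / real q"
    unfolding G_def e_def by (rule finite_variance_eq[OF q])
  also have "(\<Sum>h=1..<q. (norm (G h))\<^sup>2) \<le> (\<Sum>h=1..<q. 2 * (W h)\<^sup>2 + 2 * (W (q - h))\<^sup>2)"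
  proof (rule sum_mono)
    fix h assume "h \<in> {1..<q}"
    then have "(norm (G h))\<^sup>2 \<le> (W h + W (q - h))\<^sup>2" by (intro power_mono normG) auto
    also have "\<dots> \<le> 2 * (W h)\<^sup>2 + 2 * (W (q - h))\<^sup>2"
      using zero_le_power2[of "W h - W (q - h)"] by (simp add: power2_sum power2_diff)
    finally show "(norm (G h))\<^sup>2 \<le> 2 * (W h)\<^sup>2 + 2 * (W (q - h))\<^sup>2" .
  qed
  also have "\<dots> = 2 * (\<Sum>h=1..<q. (W h)\<^sup>2) + 2 * (\<Sum>h=1..<q. (W (q - h))\<^sup>2)"
    by (simp add: sum.distrib sum_distrib_left)
  also have "(\<Sum>h=1..<q. (W (q - h))\<^sup>2) = (\<Sum>h=1..<q. (W h)\<^sup>2)"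
    by (rule sum.reindex_bij_witness[of _ "\<lambda>h. q - h" "\<lambda>h. q - h"]) auto
  finally have "(\<Sum>a<q. (F a - (\<Sum>a<q. F a) / real q)\<^sup>2) \<le> 4 * (\<Sum>h=1..<q. (W h)\<^sup>2) / real q"
    by (simp add: divide_right_mono)
  also have "\<dots> \<le> 4 * (real (I + 1) * (\<Sum>i\<le>I. (w i)\<^sup>2 * real (card (cong_quads D (2 ^ i) q)))) / real q"
    using W2 by (intro divide_right_mono mult_left_mono) auto
  finally show ?thesis by (simp add: w_def algebra_simps)
qed

subsection \<open>Divisor and harmonic sums\<close>

lemma card_divisors_mult_le:
  fixes a b :: nat
  assumes "a > 0" "b > 0"
  shows "card {d. d dvd a * b} \<le> card {d. d dvd a} * card {d. d dvd b}"
proof -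
  have fin: "finite ({d. d dvd a} \<times> {d. d dvd b})" using assms by simp
  have "{d. d dvd a * b} \<subseteq> (\<lambda>(x, y). x * y) ` ({d. d dvd a} \<times> {d. d dvd b})"
  proof
    fix d assume "d \<in> {d. d dvd a * b}"
    then obtain x y where "d = x * y" "x dvd a" "y dvd b" by (auto elim: dvd_productE)
    then show "d \<in> (\<lambda>(x, y). x * y) ` ({d. d dvd a} \<times> {d. d dvd b})" by force
  qed
  then have "card {d. d dvd a * b} \<le> card ((\<lambda>(x, y). x * y) ` ({d. d dvd a} \<times> {d. d dvd b}))"
    using fin by (intro card_mono) auto
  also have "\<dots> \<le> card ({d. d dvd a} \<times> {d. d dvd b})" using fin by (rule card_image_le)
  finally show ?thesis by (simp only: card_cartesian_product)
qed

lemma card_divisors_prime_power_le: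
  fixes p :: nat
  assumes "prime p"
  shows "card {d. d dvd p ^ e} \<le> e + 1"
proof -
  have "{d. d dvd p ^ e} \<subseteq> (\<lambda>i. p ^ i) ` {..e}"
    using divides_primepow_nat[OF assms] by auto
  then have "card {d. d dvd p ^ e} \<le> card ((\<lambda>i. p ^ i) ` {..e})" by (intro card_mono) auto
  also have "\<dots> \<le> card {..e}" by (rule card_image_le) simp
  finally show ?thesis by simp
qed

text \<open>A full prime power \<open>p^e\<close> contributes at most \<open>e + 1\<close> divisors.
  For large p this is at most \<open>2^e\<close> and hence at most \<open>p^e\<close> to the power
  \<epsilon>; only the primes below B cost a factor C, at most \<open>C^B\<close> in all.\<close>

lemma card_divisors_le_powr:
  fixes \<epsilon> :: real
  assumes \<epsilon>: "\<epsilon> > 0"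
  obtains C where "C > 0" "\<And>n. n > 0 \<Longrightarrow> real (card {d. d dvd n}) \<le> C * real n powr \<epsilon>"
proof -
  \<comment> \<open>From B on, \<open>p powr \<epsilon>\<close> is at least 2. C satisfies
    \<open>C * (\<epsilon> * ln 2) \<ge> 1\<close>, so that \<open>exp y \<ge> 1 + y\<close> absorbs
    the exponent e for the small primes.\<close>
  define B where "B = nat \<lceil>2 powr (1 / \<epsilon>)\<rceil>"
  define C where "C = max 1 (1 / (\<epsilon> * ln 2))"
  have C1: "C \<ge> 1" by (simp add: C_def)
  have small: "real e + 1 \<le> C * real (p ^ e) powr \<epsilon>" if p: "prime p" for p e :: nat
  proof -
    have "1 / (\<epsilon> * ln 2) \<le> C" by (simp add: C_def)
    then have "1 \<le> C * (\<epsilon> * ln 2)" using \<epsilon> by (simp add: divide_le_eq)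
    then have "real e * 1 \<le> real e * (C * (\<epsilon> * ln 2))" by (intro mult_left_mono) auto
    then have "real e + 1 \<le> C * (1 + \<epsilon> * (real e * ln 2))" using C1 by (simp add: algebra_simps)
    also have "\<dots> \<le> C * exp (\<epsilon> * (real e * ln 2))"
      using C1 exp_ge_add_one_self by (intro mult_left_mono) auto
    also have "exp (\<epsilon> * (real e * ln 2)) = real (2 ^ e) powr \<epsilon>"
      by (simp add: powr_def ln_realpow)
    also have "C * real (2 ^ e) powr \<epsilon> \<le> C * real (p ^ e) powr \<epsilon>"
      using C1 \<epsilon> prime_ge_2_nat[OF p] by (intro mult_left_mono powr_mono2 of_nat_mono power_mono) auto
    finally show ?thesis .
  qed
  have large: "real e + 1 \<le> real (p ^ e) powr \<epsilon>" if p: "prime p" "B \<le> p" for p e :: nat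
  proof -
    have p0: "real p > 0" using prime_gt_0_nat[OF p(1)] by simp
    have "2 powr (1 / \<epsilon>) \<le> real p" using p(2) unfolding B_def by linarith
    then have "(2 powr (1 / \<epsilon>)) powr \<epsilon> \<le> real p powr \<epsilon>" using \<epsilon> by (intro powr_mono2) auto
    then have "2 \<le> real p powr \<epsilon>" using \<epsilon> by (simp add: powr_powr)
    then have "2 ^ e \<le> (real p powr \<epsilon>) ^ e" by (intro power_mono) auto
    also have "\<dots> = real (p ^ e) powr \<epsilon>"
      using p0 by (simp add: powr_powr mult.commute flip: powr_realpow)
    finally have "2 ^ e \<le> real (p ^ e) powr \<epsilon>" .
    moreover have "1 + real e \<le> 2 ^ e"
      using Bernoulli_inequality[of 1 e] by simp
    ultimately show ?thesis by simp
  qed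
  \<comment> \<open>The induction keeps the exact number of small primes dividing n; the uniform
    exponent B is inserted only afterwards.\<close>
  have "real (card {d. d dvd n}) \<le> C ^ card {p \<in> prime_factors n. p < B} * real n powr \<epsilon>" if "n > 0" for n :: nat
    using that
  proof (induction n rule: less_induct)
    case (less n)
    show ?case
    proof (cases "n = 1")
      case True
      then show ?thesis by simp
    next
      case False
      then obtain p where p: "prime p" "p dvd n" using prime_factor_nat by blast
      define e where "e = multiplicity p n"
      have "n \<noteq> 0" "\<not> p dvd 1" using less.prems p by (auto dest: not_prime_unit)
      then obtain m where m: "n = p ^ e * m" "\<not> p dvd m"
        unfolding e_def by (rule multiplicity_decompose')
      have "e \<noteq> 0" using m p by (intro notI) simp
      have "m > 0" using m less.prems by (intro Nat.gr0I) auto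
      have p2: "p \<ge> 2" using p prime_ge_2_nat by blast
      have "2 ^ 1 \<le> p ^ e" using p2 \<open>e \<noteq> 0\<close> 
        by (intro order_trans[OF power_mono[of 2 p 1] power_increasing[of 1 e p]]) auto
      then have "m < n" using \<open>m > 0\<close> unfolding m(1) by simp
      have IH: "real (card {d. d dvd m}) \<le> C ^ card {p \<in> prime_factors m. p < B} * real m powr \<epsilon>"
        using less.IH \<open>m < n\<close> \<open>m > 0\<close> by blast
      have "prime_factors n = prime_factors (p ^ e) \<union> prime_factors m"
        using p2 \<open>m > 0\<close> unfolding m(1) by (intro prime_factors_product) auto
      also have "prime_factors (p ^ e) = {p}"
        using p \<open>e \<noteq> 0\<close> by (simp add: prime_factors_power prime_prime_factors)
      finally have pf: "prime_factors n = insert p (prime_factors m)" by simp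
      have pm: "p \<notin> prime_factors m" using m(2) by (auto dest: dvd_prime_factors)
      have step: "(real e + 1) * C ^ card {p \<in> prime_factors m. p < B}
          \<le> C ^ card {p \<in> prime_factors n. p < B} * real (p ^ e) powr \<epsilon>"
      proof (cases "p < B")
        case True
        have "{p \<in> prime_factors n. p < B} = insert p {p \<in> prime_factors m. p < B}"
          using pf True by auto
        then have "card {p \<in> prime_factors n. p < B} = Suc (card {p \<in> prime_factors m. p < B})"
          using pm by simp
        then show ?thesis
          using mult_right_mono[OF small[OF p(1), of e], of "C ^ card {p \<in> prime_factors m. p < B}"] C1
          by (simp add: mult_ac)
      next
        case False
        have "{p \<in> prime_factors n. p < B} = {p \<in> prime_factors m. p < B}"
          using pf False by auto
        then show ?thesis
          using mult_right_mono[OF large[OF p(1), of e], of "C ^ card {p \<in> prime_factors m. p < B}"] C1 False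
          by (simp add: mult_ac)
      qed
      have "card {d. d dvd n} \<le> card {d. d dvd p ^ e} * card {d. d dvd m}"
        unfolding m(1) using p2 \<open>m > 0\<close> by (intro card_divisors_mult_le) auto
      also have "\<dots> \<le> (e + 1) * card {d. d dvd m}"
        by (intro mult_le_mono1 card_divisors_prime_power_le[OF p(1)])
      finally have "real (card {d. d dvd n}) \<le> real ((e + 1) * card {d. d dvd m})"
        by (rule of_nat_mono)
      also have "\<dots> = (real e + 1) * real (card {d. d dvd m})" by (simp add: algebra_simps)
      also have "(real e + 1) * real (card {d. d dvd m}) \<le> (real e + 1) * (C ^ card {p \<in> prime_factors m. p < B} * real m powr \<epsilon>)"
        using IH by (intro mult_left_mono) auto
      also have "\<dots> \<le> C ^ card {p \<in> prime_factors n. p < B} * real (p ^ e) powr \<epsilon> * real m powr \<epsilon>"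
        using mult_right_mono[OF step, of "real m powr \<epsilon>"] by (simp add: mult_ac)
      also have "\<dots> = C ^ card {p \<in> prime_factors n. p < B} * real n powr \<epsilon>"
        unfolding m(1) of_nat_mult by (simp add: powr_mult mult_ac)
      finally show ?thesis .
    qed
  qed
  moreover have "C ^ card {p \<in> prime_factors n. p < B} \<le> C ^ B" for n :: nat
    using C1 card_mono[of "{..<B}" "{p \<in> prime_factors n. p < B}"] by (intro power_increasing) auto
  ultimately have "real (card {d. d dvd n}) \<le> C ^ B * real n powr \<epsilon>" if "n > 0" for n :: nat
    using that by (meson mult_right_mono order_trans powr_ge_zero)
  then show ?thesis using C1 by (intro that[of "C ^ B"]) auto
qed

lemma harmonic_sum_le: "(\<Sum>k=1..n. 1 / real k) \<le> 1 + ln (real n)" if "n > 0"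
  using that
proof (induction n rule: nat_induct_non_zero)
  case (Suc n)
  have "ln (real n / real (Suc n)) \<le> real n / real (Suc n) - 1"
    using Suc.hyps by (intro ln_le_minus_one) auto
  also have "\<dots> = - (1 / real (Suc n))" by (simp add: field_simps)
  finally have "1 / real (Suc n) \<le> ln (real (Suc n)) - ln (real n)"
    using Suc.hyps by (simp add: ln_div)
  then show ?case using Suc.IH by simp
qed simp

subsection \<open>Variance of a dyadic block\<close>

text \<open>The two quantities have product \<open>x q\<close>, so the smaller is at most their
  geometric mean.\<close>

lemma min_divide_mult_le_sqrt:
  fixes x q P :: real
  assumes "x > 0" "q > 0" "P > 0"
  shows "min (x / P) (P * q) \<le> sqrt x * sqrt q"
proof (cases "P\<^sup>2 * q \<le> x")
  case True
  have "(P * q)\<^sup>2 = P\<^sup>2 * q * q" by (simp add: power2_eq_square)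
  also have "\<dots> \<le> x * q" using True assms by (intro mult_right_mono) auto
  finally have "P * q \<le> sqrt (x * q)" by (rule real_le_rsqrt)
  then show ?thesis by (simp add: real_sqrt_mult)
next
  case False
  have "(x / P)\<^sup>2 = x * x / P\<^sup>2" by (simp add: power2_eq_square)
  also have "\<dots> \<le> x * (P\<^sup>2 * q) / P\<^sup>2"
    using False assms by (intro divide_right_mono mult_left_mono) auto
  also have "\<dots> = x * q" using assms by simp
  finally have "x / P \<le> sqrt (x * q)" by (rule real_le_rsqrt)
  then show ?thesis by (simp add: real_sqrt_mult)
qed

text \<open>\<open>VA\<close> comes from Parseval, \<open>VB\<close> from the second moment. L
  majorises every logarithm that occurs: in \<open>VA\<close> the two harmonic sums give
  \<open>L^2\<close>, and the factor \<open>I + 1\<close> enters twice, by Cauchy-Schwarz and by the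
  number of scales.\<close>

lemma block_variance_le:
  fixes x L :: real and q P N I :: nat
  assumes q: "q > 0" "real q \<le> x" and P: "P > 0"
    and A: "A \<subseteq> {1..2 * P}" "\<And>d. d \<in> A \<Longrightarrow> coprime d q"
    and c: "\<And>d. d \<in> A \<Longrightarrow> \<bar>c d\<bar> \<le> 1" and M: "\<And>d. d \<in> A \<Longrightarrow> M d \<le> N"
    and N: "real N * (real P)\<^sup>2 \<le> x"
    and I: "q \<le> 2 ^ I" "real (I + 1) \<le> L" and L: "1 \<le> L"
    and H: "(\<Sum>k=1..2 * P. 1 / real k) \<le> L" "(\<Sum>k=1..N. 1 / real k) \<le> L" "(\<Sum>k=1..2 ^ I. 1 / real k) \<le> L"
  defines "F \<equiv> progression_weight c M A q"
  shows "(\<Sum>a<q. (F a - (\<Sum>a<q. F a) / real q)\<^sup>2)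
    \<le> 256 * real (card {g. g dvd q}) * L ^ 4 * (sqrt x * sqrt (real q) + x / sqrt (real q))"
proof -
  define V where "V = (\<Sum>a<q. (F a - (\<Sum>a<q. F a) / real q)\<^sup>2)"
  define \<tau> where "\<tau> = real (card {g. g dvd q})"
  define Q where "Q = real q"
  define p where "p = real P"
  define E where "E = sqrt x * sqrt Q + x / sqrt Q"
  have pos: "Q > 0" "p > 0" "x > 0" using q P by (auto simp: Q_def p_def)
  have Q1: "Q \<ge> 1" using q by (simp add: Q_def)
  have \<tau>0: "\<tau> \<ge> 0" by (simp add: \<tau>_def)
  have Hnn: "0 \<le> (\<Sum>k=1..n. 1 / real k)" for n by (intro sum_nonneg) auto
  have count: "real (card (cong_quads (2 * P) K q)) \<le> 4 * \<tau> * L\<^sup>2 * (4 * p\<^sup>2 * (real K)\<^sup>2 / Q + 2 * p * real K)"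
    if "(\<Sum>k=1..K. 1 / real k) \<le> L" for K
  proof -
    have "real (card (cong_quads (2 * P) K q))
        \<le> 4 * \<tau> * ((\<Sum>e=1..2 * P. 1 / real e) * (\<Sum>f=1..K. 1 / real f)) * ((2 * p)\<^sup>2 * (real K)\<^sup>2 / Q + 2 * p * real K)"
      using cong_quads_card_le[OF q(1), of "2 * P" K] by (simp add: \<tau>_def Q_def p_def mult.assoc)
    also have "\<dots> \<le> 4 * \<tau> * (L * L) * ((2 * p)\<^sup>2 * (real K)\<^sup>2 / Q + 2 * p * real K)"
      using that H(1) \<tau>0 pos L Hnn by (intro mult_right_mono mult_left_mono mult_mono) auto
    finally show ?thesis by (simp add: power2_eq_square mult_ac)
  qed
  have Np: "real N \<le> x / p\<^sup>2" using N pos by (simp add: p_def field_simps)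
  have VA: "V \<le> 256 * \<tau> * L ^ 4 * (p\<^sup>2 + sqrt x * sqrt Q)"
  proof -
    define w where "w = (\<lambda>i. min (real N) (2 * Q / 2 ^ i))"
    \<comment> \<open>This bounds the diagonal part \<open>2 p (w i)(w i K)\<close> of one scale
      divided by Q: \<open>w i K \<le> 2 Q\<close> is combined with \<open>w i \<le> N\<close> for
      the first entry and with \<open>w i \<le> 2 Q\<close> for the second.\<close>
    define m where "m = min (4 * p * real N) (8 * p * Q)"
    have m0: "m \<ge> 0" using pos by (simp add: m_def)
    have term_le: "(w i)\<^sup>2 * real (card (cong_quads (2 * P) (2 ^ i) q)) \<le> 4 * \<tau> * L\<^sup>2 * Q * (16 * p\<^sup>2 + m)"
      if i: "i \<le> I" for i
    proof -
      define K where "K = (2::real) ^ i"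
      have K: "K \<ge> 1" by (simp add: K_def)
      have w0: "0 \<le> w i" using pos by (simp add: w_def)
      have wK: "w i * K \<le> 2 * Q"
      proof -
        have "w i \<le> 2 * Q / K" by (simp add: w_def K_def)
        then show ?thesis using K by (simp add: pos_le_divide_eq)
      qed
      have wN: "w i \<le> real N" by (simp add: w_def)
      have "(\<Sum>k=1..(2::nat) ^ i. 1 / real k) \<le> (\<Sum>k=1..2 ^ I. 1 / real k)"
        using i power_increasing[of i I "2::nat"] by (intro sum_mono2) auto
      then have "(\<Sum>k=1..(2::nat) ^ i. 1 / real k) \<le> L" using H(3) by linarith
      from count[OF this]
      have "(w i)\<^sup>2 * real (card (cong_quads (2 * P) (2 ^ i) q))
          \<le> (w i)\<^sup>2 * (4 * \<tau> * L\<^sup>2 * (4 * p\<^sup>2 * K\<^sup>2 / Q + 2 * p * K))"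
        by (intro mult_left_mono) (auto simp: K_def)
      also have "\<dots> = 4 * \<tau> * L\<^sup>2 * (4 * p\<^sup>2 * (w i * K)\<^sup>2 / Q + 2 * p * (w i * (w i * K)))"
        by (simp add: power2_eq_square algebra_simps)
      also have "\<dots> \<le> 4 * \<tau> * L\<^sup>2 * (16 * p\<^sup>2 * Q + m * Q)"
      proof (intro mult_left_mono add_mono)
        have "(w i * K)\<^sup>2 \<le> (2 * Q)\<^sup>2" using wK w0 K by (intro power_mono) auto
        then have "4 * p\<^sup>2 * (w i * K)\<^sup>2 / Q \<le> 4 * p\<^sup>2 * (2 * Q)\<^sup>2 / Q"
          using pos by (intro divide_right_mono mult_left_mono) auto
        also have "\<dots> = 16 * p\<^sup>2 * Q" using pos by (simp add: power2_eq_square)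
        finally show "4 * p\<^sup>2 * (w i * K)\<^sup>2 / Q \<le> 16 * p\<^sup>2 * Q" .
        have "w i * (w i * K) \<le> real N * (2 * Q)"
          using w0 K by (intro mult_mono[OF wN wK]) auto
        moreover have "w i * 1 \<le> w i * K" using w0 K by (intro mult_left_mono) auto
        then have "w i \<le> 2 * Q" using wK by linarith
        from mult_mono[OF this wK] have "w i * (w i * K) \<le> (2 * Q) * (2 * Q)"
          using w0 K pos by simp
        ultimately have "2 * p * (w i * (w i * K)) \<le> min (2 * p * (real N * (2 * Q))) (2 * p * ((2 * Q) * (2 * Q)))"
          using pos by (intro min.boundedI mult_left_mono) auto
        also have "\<dots> = m * Q" using pos by (auto simp: m_def min_def)
        finally show "2 * p * (w i * (w i * K)) \<le> m * Q" .
      qed (use \<tau>0 in auto)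
      finally show ?thesis by (simp add: algebra_simps)
    qed
    have "V \<le> 4 * real (I + 1) / real q * (\<Sum>i\<le>I. (w i)\<^sup>2 * real (card (cong_quads (2 * P) (2 ^ i) q)))"
      unfolding V_def F_def w_def Q_def by (rule progression_weight_variance_le) (use q A c M I in auto)
    also have "\<dots> \<le> 4 * real (I + 1) / real q * (\<Sum>i\<le>I. 4 * \<tau> * L\<^sup>2 * Q * (16 * p\<^sup>2 + m))"
      by (intro mult_left_mono sum_mono term_le) auto
    also have "\<dots> = 16 * \<tau> * L\<^sup>2 * (real (I + 1))\<^sup>2 * (16 * p\<^sup>2 + m)"
      using pos by (simp add: Q_def power2_eq_square field_simps)
    also have "\<dots> \<le> 16 * \<tau> * L\<^sup>2 * L\<^sup>2 * (16 * p\<^sup>2 + m)"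
      using I(2) L \<tau>0 m0 by (intro mult_right_mono mult_left_mono power_mono) auto
    also have "\<dots> = 16 * \<tau> * L ^ 4 * (16 * p\<^sup>2 + m)"
      by (simp add: power2_eq_square power4_eq_xxxx)
    \<comment> \<open>In fact m is at most 8 times the root; 16 lets the same factor come out of
      both terms, giving 256.\<close>
    also have "\<dots> \<le> 16 * \<tau> * L ^ 4 * (16 * p\<^sup>2 + 16 * (sqrt x * sqrt Q))"
    proof (intro mult_left_mono add_left_mono)
      have "p * real N \<le> x / p" using mult_left_mono[OF Np, of p] pos by (simp add: power2_eq_square)
      moreover have "m \<le> 4 * (p * real N)" and m8: "m \<le> 8 * (p * Q)" by (simp_all add: m_def)
      moreover have "0 \<le> x / p" using pos by simp
      ultimately have "m / 8 \<le> x / p" by argo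
      moreover have "m / 8 \<le> p * Q" using m8 by argo
      ultimately have "m / 8 \<le> min (x / p) (p * Q)" by simp
      also have "\<dots> \<le> sqrt x * sqrt Q" by (rule min_divide_mult_le_sqrt[OF pos(3,1,2)])
      finally show "m \<le> 16 * (sqrt x * sqrt Q)" using m0 by simp
    qed (use \<tau>0 L in auto)
    finally show ?thesis by (simp add: algebra_simps)
  qed
  have VB: "V \<le> 16 * \<tau> * L\<^sup>2 * (x\<^sup>2 / (p\<^sup>2 * Q) + x / p)"
  proof -
    have "V = (\<Sum>a<q. (F a)\<^sup>2) - (\<Sum>a<q. F a)\<^sup>2 / real q"
      unfolding V_def using q(1) by (rule sum_square_deviation_eq)
    also have "\<dots> \<le> (\<Sum>a<q. (F a)\<^sup>2)" by simp
    also have "\<dots> \<le> real (card (cong_quads (2 * P) N q))"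
      unfolding F_def by (rule progression_weight_sum_squares_le) (use q A c M in auto)
    also have "\<dots> \<le> 4 * \<tau> * L\<^sup>2 * (4 * p\<^sup>2 * (real N)\<^sup>2 / Q + 2 * p * real N)"
      by (rule count[OF H(2)])
    also have "\<dots> \<le> 4 * \<tau> * L\<^sup>2 * (4 * p\<^sup>2 * (x / p\<^sup>2)\<^sup>2 / Q + 2 * p * (x / p\<^sup>2))"
      using Np pos \<tau>0 by (intro mult_left_mono add_mono divide_right_mono power_mono) auto
    also have "\<dots> = 4 * \<tau> * L\<^sup>2 * (4 * (x\<^sup>2 / (p\<^sup>2 * Q)) + 2 * (x / p))"
      using pos by (simp add: field_simps power2_eq_square)
    also have "\<dots> \<le> 4 * \<tau> * L\<^sup>2 * (4 * (x\<^sup>2 / (p\<^sup>2 * Q)) + 4 * (x / p))"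
      using pos \<tau>0 by (intro mult_left_mono add_left_mono mult_right_mono) auto
    finally show ?thesis by (simp add: algebra_simps)
  qed
  have sQ: "sqrt Q * sqrt Q = Q" "sqrt x * sqrt x = x" using pos by auto
  have sQ1: "sqrt Q \<ge> 1" using Q1 by simp
  have "V \<le> 256 * \<tau> * L ^ 4 * E"
  proof (cases "p\<^sup>2 \<le> x / sqrt Q")
    case True
    then have "p\<^sup>2 + sqrt x * sqrt Q \<le> E" by (simp add: E_def)
    then have "256 * \<tau> * L ^ 4 * (p\<^sup>2 + sqrt x * sqrt Q) \<le> 256 * \<tau> * L ^ 4 * E"
      using \<tau>0 L by (intro mult_left_mono) auto
    then show ?thesis using VA by linarith
  next
    case False
    then have ge: "p\<^sup>2 \<ge> x / sqrt Q" by simp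
    have "x\<^sup>2 / (p\<^sup>2 * Q) \<le> x\<^sup>2 / (x / sqrt Q * Q)"
      using ge pos by (intro divide_left_mono mult_right_mono mult_pos_pos) auto
    also have "\<dots> = x / sqrt Q"
      using pos sQ by (simp add: field_simps power2_eq_square)
    finally have 1: "x\<^sup>2 / (p\<^sup>2 * Q) \<le> x / sqrt Q" .
    \<comment> \<open>Above the threshold the diagonal term is at most the root of
      \<open>x * sqrt Q\<close>, and \<open>Q \<ge> 1\<close> brings this below the root of
      \<open>x * Q\<close>.\<close>
    have "(x / p)\<^sup>2 = x\<^sup>2 / p\<^sup>2" by (simp add: power_divide)
    also have "\<dots> \<le> x\<^sup>2 / (x / sqrt Q)" using ge pos by (intro divide_left_mono mult_pos_pos) auto
    also have "\<dots> = x * sqrt Q" using pos by (simp add: power2_eq_square)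
    also have "\<dots> \<le> x * Q" using mult_left_mono[OF sQ1, of "sqrt Q"] sQ pos by (intro mult_left_mono) auto
    finally have "x / p \<le> sqrt (x * Q)" by (rule real_le_rsqrt)
    then have 2: "x / p \<le> sqrt x * sqrt Q" by (simp add: real_sqrt_mult)
    have "V \<le> 16 * \<tau> * L\<^sup>2 * E"
      using VB 1 2 \<tau>0 unfolding E_def
      by (elim order_trans) (intro mult_left_mono, auto)
    also have "\<dots> \<le> 256 * \<tau> * L ^ 4 * E"
      using \<tau>0 L pos power_increasing[of 2 4 L] unfolding E_def
      by (intro mult_right_mono mult_mono) auto
    finally show ?thesis .
  qed
  then show ?thesis by (simp only: V_def \<tau>_def E_def Q_def)
qed

subsection \<open>Squarefree numbers and reduced residue classes\<close>

text \<open>Only squarefree divisors count, and these are the products of the subsets of the set of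
  prime factors.\<close>

lemma sum_moebius_mu_divisors:
  fixes s :: nat
  assumes s: "s > 0"
  shows "(\<Sum>d | d dvd s. moebius_mu d) = (if s = 1 then 1 else 0)"
proof -
  have "(\<Sum>d | d dvd s. moebius_mu d) = (\<Sum>d | d dvd s \<and> squarefree d. moebius_mu d)"
    using s by (intro sum.mono_neutral_right) (auto simp: moebius_mu_def)
  also have "\<dots> = (\<Sum>T\<in>Pow (prime_factors s). (-1) ^ card T)"
  proof (rule sum.reindex_bij_witness[where i = "\<lambda>T. \<Prod>T" and j = prime_factors])
    fix d assume d: "d \<in> {d. d dvd s \<and> squarefree d}"
    then have "d > 0" using s by (auto intro: Nat.gr0I)
    have "(\<Prod>p\<in>prime_factors d. p) = (\<Prod>p\<in>prime_factors d. p ^ multiplicity p d)"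
      using d \<open>d > 0\<close> squarefree_factorial_semiring'[of d] by (intro prod.cong) auto
    also have "\<dots> = d" using \<open>d > 0\<close> by (subst prod_prime_factors) auto
    finally show "\<Prod>(prime_factors d) = d" .
    show "prime_factors d \<in> Pow (prime_factors s)"
      using d s by (auto intro: dvd_prime_factors[THEN subsetD])
    show "(-1) ^ card (prime_factors d) = moebius_mu d" using d by (simp add: moebius_mu_def)
  next
    fix T assume T: "T \<in> Pow (prime_factors s)"
    then have fin: "finite T" and pr: "\<And>p. p \<in> T \<Longrightarrow> prime p" by (auto intro: finite_subset)
    have nz: "\<Prod>T \<noteq> 0" using fin pr by (auto dest: prime_gt_0_nat)
    have "prime_factors (\<Prod>T) = (\<Union>p\<in>T. prime_factors p)"
      using fin pr prime_factors_prod[of T "\<lambda>p. p"] by (auto dest: prime_gt_0_nat)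
    also have "\<dots> = (\<Union>p\<in>T. {p})" using pr by (intro SUP_cong) (auto simp: prime_prime_factors)
    finally show pf: "prime_factors (\<Prod>T) = T" by simp
    have sq: "squarefree (\<Prod>T)"
      using pr by (intro squarefree_prod_coprime) (auto intro: primes_coprime squarefree_prime)
    have "\<Prod>T dvd s"
    proof (subst prime_multiplicity_le_imp_dvd)
      show "\<forall>p. prime p \<longrightarrow> multiplicity p (\<Prod>T) \<le> multiplicity p s"
      proof (intro allI impI)
        fix p :: nat assume p: "prime p"
        show "multiplicity p (\<Prod>T) \<le> multiplicity p s"
        proof (cases "p dvd \<Prod>T")
          case True
          then have "p \<in> prime_factors (\<Prod>T)" using p nz by (simp only: in_prime_factors_iff simp_thms)
          then have "p \<in> T" unfolding pf .
          then have "p dvd s" using T by auto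
          then have "multiplicity p s \<ge> 1" using p s by (intro multiplicity_geI) auto
          moreover have "multiplicity p (\<Prod>T) \<le> 1" using sq p nz squarefree_factorial_semiring'' by blast
          ultimately show ?thesis by linarith
        qed (simp add: not_dvd_imp_multiplicity_0)
      qed
    qed (use s nz in auto)
    then show "\<Prod>T \<in> {d. d dvd s \<and> squarefree d}" using sq by simp
  qed
  \<comment> \<open>Factors 1 over the complement give the expanded form of a product of terms
    \<open>-1 + 1\<close>, which vanishes once s has a prime factor.\<close>
  also have "\<dots> = (\<Sum>T\<in>Pow (prime_factors s). (\<Prod>p\<in>T. - 1) * (\<Prod>p\<in>prime_factors s - T. 1))"
    by simp
  also have "\<dots> = (\<Prod>p\<in>prime_factors s. - 1 + 1 :: int)"
    by (rule prod_add[symmetric]) simp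
  also have "\<dots> = (if s = 1 then 1 else 0)"
  proof (cases "s = 1")
    case False
    then obtain p where "prime p" "p dvd s" using prime_factor_nat by blast
    then have "p \<in> prime_factors s" using s by (intro prime_factorsI) auto
    then have "(\<Prod>p\<in>prime_factors s. - 1 + 1 :: int) = 0" by (intro prod_zero) auto
    then show ?thesis using False by simp
  qed simp
  finally show ?thesis .
qed

text \<open>\<open>d^2\<close> divides n exactly when d divides the square part of n, so the sum
  tests whether that part is 1.\<close>

lemma abs_moebius_mu_eq_sum:
  fixes n :: nat
  assumes n: "n > 0"
  shows "\<bar>moebius_mu n\<bar> = (\<Sum>d | d\<^sup>2 dvd n. moebius_mu d)"
proof -
  have "square_part n > 0" using n by (metis neq0_conv square_part_0_iff)
  moreover have "square_part n = 1 \<longleftrightarrow> squarefree n"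
  proof
    assume "square_part n = 1"
    then show "squarefree n" by (intro squarefreeI) (simp flip: dvd_square_part_iff)
  next
    assume "squarefree n"
    then show "square_part n = 1" using squarefreeD[of n "square_part n"] by simp
  qed
  moreover have "\<bar>moebius_mu n\<bar> = (if squarefree n then 1 else 0)"
    by (simp add: moebius_mu_def power_abs)
  ultimately show ?thesis
    using sum_moebius_mu_divisors[of "square_part n"] by (simp add: dvd_square_part_iff)
qed

lemma abs_moebius_mu_le_1: "\<bar>moebius_mu n\<bar> \<le> 1"
  by (simp add: moebius_mu_def power_abs)

section \<open>Reduced residue classes as units of \<open>ZFact\<close>\<close>

lemma carrier_ZFact: "carrier (ZFact k) = range (ZMod k)"
  by (auto simp: ZFact_defs A_RCOSETS_def' ZMod_def)

lemma one_ZFact: "\<one>\<^bsub>ZFact k\<^esub> = ZMod k 1"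
  by (simp add: ZFact_defs ZMod_def)

lemma mult_ZFact: "ZMod k a \<otimes>\<^bsub>ZFact k\<^esub> ZMod k b = ZMod k (a * b)"
  using ideal.rcoset_mult_add[OF int.genideal_ideal[of "{k}"], of a b]
  by (simp add: ZFact_defs ZMod_def)

lemma ZMod_in_Units_ZFact_iff: "ZMod k a \<in> Units (ZFact k) \<longleftrightarrow> coprime a k"
proof -
  have "ZMod k a \<in> Units (ZFact k) \<longleftrightarrow> (\<exists>b. [a * b = 1] (mod k))"
    by (auto simp: Units_def carrier_ZFact one_ZFact mult_ZFact ZMod_eq_mod cong_def mult.commute)
  then show ?thesis by (simp add: coprime_iff_invertible_int)
qed

text \<open>Representatives start at 0 in order to match \<open>n mod q\<close>. For q = 1 the only
  class is represented by 0, which is coprime to 1.\<close>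

lemma bij_betw_ZMod_Units:
  assumes "q > 0"
  shows "bij_betw (\<lambda>a. ZMod (int q) (int a)) {a. a < q \<and> coprime a q} (Units (ZFact (int q)))"
proof (rule bij_betw_imageI)
  show "inj_on (\<lambda>a. ZMod (int q) (int a)) {a. a < q \<and> coprime a q}"
    by (auto simp: inj_on_def ZMod_eq_mod)
  show "(\<lambda>a. ZMod (int q) (int a)) ` {a. a < q \<and> coprime a q} = Units (ZFact (int q))"
  proof safe
    fix a assume "coprime a q"
    then show "ZMod (int q) (int a) \<in> Units (ZFact (int q))" by (simp add: ZMod_in_Units_ZFact_iff)
  next
    fix A assume A: "A \<in> Units (ZFact (int q))"
    then have "A \<in> carrier (ZFact (int q))" by (simp add: Units_def)
    then obtain z where z: "A = ZMod (int q) z" by (auto simp: carrier_ZFact)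
    define a where "a = nat (z mod int q)"
    have a: "int a = z mod int q" using assms by (simp add: a_def)
    then have Aa: "A = ZMod (int q) (int a)" by (simp add: z ZMod_eq_mod)
    moreover have "a < q" using a assms by (metis of_nat_0_less_iff of_nat_less_iff pos_mod_bound)
    moreover have "coprime a q" using A Aa by (simp add: ZMod_in_Units_ZFact_iff)
    ultimately show "A \<in> (\<lambda>a. ZMod (int q) (int a)) ` {a. a < q \<and> coprime a q}" by auto
  qed
qed

lemma card_Units_ZFact:
  assumes "q > 0"
  shows "card (Units (ZFact (int q))) = totient q"
proof -
  \<comment> \<open>Totatives lie in 1..q and representatives below q; reduction modulo q moves an
    element only for q = 1, where it sends 1 to 0.\<close>
  have "bij_betw (\<lambda>a. a mod q) (totatives q) {a. a < q \<and> coprime a q}"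
  proof (cases "q = 1")
    case True
    then show ?thesis by (auto simp: bij_betw_def)
  next
    case False
    have "a > 0" if "coprime a q" for a using that False by (intro Nat.gr0I) auto
    then have eq: "totatives q = {a. a < q \<and> coprime a q}"
      using assms False totatives_less[of _ q] by (auto simp: in_totatives_iff)
    show ?thesis
      unfolding eq by (rule bij_betw_imageI) (auto simp: inj_on_def image_iff)
  qed
  from bij_betw_same_card[OF this] bij_betw_same_card[OF bij_betw_ZMod_Units[OF assms]]
  show ?thesis by (simp add: totient_def)
qed

text \<open>Put \<open>t = s - c\<close>. As \<gamma> permutes U, the parts of both expressions that
  involve c coincide and cancel. What remains is the correlation of t with its permutation and the
  square of its sum over the size of U, each at most the sum of the squares of t.\<close>

lemma correlation_le_variance:
  fixes s :: "'a \<Rightarrow> real"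
  assumes fin: "finite U" and \<gamma>: "bij_betw \<gamma> U U"
  shows "\<bar>(\<Sum>A\<in>U. s (\<gamma> A) * s A) - (\<Sum>A\<in>U. s A)\<^sup>2 / real (card U)\<bar> \<le> 2 * (\<Sum>A\<in>U. (s A - c)\<^sup>2)"
proof (cases "U = {}")
  case False
  define t where "t = (\<lambda>A. s A - c)"
  define n where "n = real (card U)"
  have n: "n > 0" using False fin by (simp add: n_def card_gt_0_iff)
  have re: "(\<Sum>A\<in>U. g (\<gamma> A)) = (\<Sum>A\<in>U. g A)" for g :: "'a \<Rightarrow> real"
    by (rule sum.reindex_bij_betw[OF \<gamma>])
  have "(\<Sum>A\<in>U. s (\<gamma> A) * s A) = (\<Sum>A\<in>U. t (\<gamma> A) * t A + c * t (\<gamma> A) + c * t A + c\<^sup>2)"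
    by (intro sum.cong refl) (simp add: t_def algebra_simps power2_eq_square)
  also have "\<dots> = (\<Sum>A\<in>U. t (\<gamma> A) * t A) + 2 * c * (\<Sum>A\<in>U. t A) + n * c\<^sup>2"
    by (simp add: sum.distrib re n_def flip: sum_distrib_left)
  finally have 1: "(\<Sum>A\<in>U. s (\<gamma> A) * s A) = (\<Sum>A\<in>U. t (\<gamma> A) * t A) + 2 * c * (\<Sum>A\<in>U. t A) + n * c\<^sup>2" .
  have "(\<Sum>A\<in>U. s A) = (\<Sum>A\<in>U. t A) + n * c"
    by (simp add: t_def sum_subtractf n_def)
  then have 2: "(\<Sum>A\<in>U. s A)\<^sup>2 / n = (\<Sum>A\<in>U. t A)\<^sup>2 / n + 2 * c * (\<Sum>A\<in>U. t A) + n * c\<^sup>2"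
    using n by (simp add: power2_sum add_divide_distrib power_mult_distrib) (simp add: power2_eq_square)
  have "(\<Sum>A\<in>U. \<bar>t (\<gamma> A) * t A\<bar>) \<le> (\<Sum>A\<in>U. (t (\<gamma> A))\<^sup>2 / 2 + (t A)\<^sup>2 / 2)"
  proof (rule sum_mono)
    fix A
    have "0 \<le> (\<bar>t (\<gamma> A)\<bar> - \<bar>t A\<bar>)\<^sup>2" by simp
    then show "\<bar>t (\<gamma> A) * t A\<bar> \<le> (t (\<gamma> A))\<^sup>2 / 2 + (t A)\<^sup>2 / 2"
      by (simp add: power2_diff abs_mult)
  qed
  also have "\<dots> = (\<Sum>A\<in>U. (t A)\<^sup>2)"
    by (simp add: sum.distrib re[of "\<lambda>A. (t A)\<^sup>2"] flip: sum_divide_distrib)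
  finally have 3: "\<bar>\<Sum>A\<in>U. t (\<gamma> A) * t A\<bar> \<le> (\<Sum>A\<in>U. (t A)\<^sup>2)"
    using sum_abs[of "\<lambda>A. t (\<gamma> A) * t A" U] by linarith
  have "(\<Sum>A\<in>U. t A)\<^sup>2 / n \<le> (\<Sum>A\<in>U. (t A)\<^sup>2)"
    using sum_squared_le_sum_of_squares[of t U] n by (simp add: n_def divide_le_eq)
  moreover have "0 \<le> (\<Sum>A\<in>U. t A)\<^sup>2 / n" using n by simp
  ultimately show ?thesis using 1 2 3 unfolding n_def t_def by linarith
qed simp

section \<open>Squarefree numbers in reduced classes\<close>

lemma sum_dyadic_blocks:
  fixes g :: "nat \<Rightarrow> real"
  shows "(\<Sum>j\<le>J. \<Sum>d=2^j..<2^Suc j. g d) = (\<Sum>d=1..<2^Suc J. g d)"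
proof (induction J)
  case (Suc J)
  have "(\<Sum>d=1..<2^Suc J. g d) + (\<Sum>d=2^Suc J..<2^Suc (Suc J). g d) = (\<Sum>d=1..<2^Suc (Suc J). g d)"
    by (rule sum.atLeastLessThan_concat) auto
  then show ?case by (simp only: sum.atMost_Suc Suc.IH)
qed simp

text \<open>Writing \<open>n = m d^2\<close>, the coprimality of n to q passes to d, and
  \<open>d^2 \<le> x < 4^(J+1)\<close> confines d to the blocks up to J.\<close>

lemma progression_sum_abs_moebius_mu:
  fixes x :: real and q a J :: nat
  assumes q: "q > 0" and a: "coprime a q" and x: "x < 4 ^ Suc J"
  shows "(\<Sum>n | 1 \<le> n \<and> real n \<le> x \<and> n mod q = a. real_of_int \<bar>moebius_mu n\<bar>)
    = (\<Sum>j\<le>J. progression_weight (\<lambda>d. real_of_int (moebius_mu d)) (\<lambda>d. nat \<lfloor>x / (real d)\<^sup>2\<rfloor>)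
                {d \<in> {2^j..<2^Suc j}. coprime d q} q a)"
proof -
  define \<mu> where "\<mu> = (\<lambda>d. real_of_int (moebius_mu d))"
  define Ns where "Ns = {n::nat. 1 \<le> n \<and> real n \<le> x \<and> n mod q = a}"
  define Ms where "Ms = (\<lambda>d::nat. {m \<in> {1..nat \<lfloor>x / (real d)\<^sup>2\<rfloor>}. m * d\<^sup>2 mod q = a})"
  define Ds where "Ds = {d \<in> {1..<2^Suc J}. coprime d q}"
  have finN: "finite Ns" by (rule finite_subset[of _ "{..nat \<lfloor>x\<rfloor>}"]) (auto simp: Ns_def le_nat_floor)
  have "(\<Sum>n\<in>Ns. real_of_int \<bar>moebius_mu n\<bar>) = (\<Sum>n\<in>Ns. \<Sum>d | d\<^sup>2 dvd n. \<mu> d)"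
    by (intro sum.cong refl) (simp add: Ns_def abs_moebius_mu_eq_sum \<mu>_def)
  also have "\<dots> = (\<Sum>(n, d)\<in>(SIGMA n:Ns. {d. d\<^sup>2 dvd n}). \<mu> d)"
  proof (rule sum.Sigma[OF finN], rule ballI)
    fix n assume "n \<in> Ns"
    then have "n > 0" by (simp add: Ns_def)
    show "finite {d. d\<^sup>2 dvd n}"
    proof (rule finite_subset)
      show "{d. d\<^sup>2 dvd n} \<subseteq> {d. d dvd n}" by (auto intro: dvd_trans[OF dvd_power])
      show "finite {d. d dvd n}" using \<open>n > 0\<close> by simp
    qed
  qed
  also have "\<dots> = (\<Sum>(d, m)\<in>(SIGMA d:Ds. Ms d). \<mu> d)"
  proof (rule sum.reindex_bij_witness[where i = "\<lambda>(d, m). (m * d\<^sup>2, d)" and j = "\<lambda>(n, d). (d, n div d\<^sup>2)"], goal_cases)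
    case (2 p)
    then obtain n d where p: "p = (n, d)" "n \<in> Ns" "d\<^sup>2 dvd n" by auto
    then obtain m where m: "n = d\<^sup>2 * m" by (auto elim: dvdE)
    have n: "1 \<le> n" "real n \<le> x" "n mod q = a" using p by (auto simp: Ns_def)
    have pos: "d > 0" "m > 0" using n m by (auto intro!: Nat.gr0I)
    have "coprime n q" using a n(3) q by (metis coprime_mod_left_iff neq0_conv)
    then have "coprime d q" using m by simp
    have "(real d)\<^sup>2 * real m \<le> x" using n(2) m by simp
    then have mle: "real m \<le> x / (real d)\<^sup>2" using pos by (simp add: field_simps)
    have "(real d)\<^sup>2 * 1 \<le> (real d)\<^sup>2 * real m" using pos by (intro mult_left_mono) auto
    then have "(real d)\<^sup>2 < 4 ^ Suc J" using \<open>(real d)\<^sup>2 * real m \<le> x\<close> x by linarith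
    also have "(4::real) ^ Suc J = (2 ^ Suc J)\<^sup>2" by (simp add: power_even_eq power2_eq_square flip: power_mult_distrib)
    finally have "real d < 2 ^ Suc J" by (rule power_less_imp_less_base) simp
    then have "d < 2 ^ Suc J" by (metis of_nat_less_iff of_nat_numeral of_nat_power)
    then have "d \<in> Ds" using pos \<open>coprime d q\<close> by (simp add: Ds_def)
    moreover have "m \<in> Ms d" using pos n(3) m mle by (simp add: Ms_def le_nat_floor mult.commute)
    ultimately show ?case using p m pos by simp
  next
    case (4 p)
    then obtain d m where p: "p = (d, m)" "d \<in> Ds" "m \<in> Ms d" by auto
    then have r: "d > 0" "1 \<le> m" "m \<le> nat \<lfloor>x / (real d)\<^sup>2\<rfloor>" "m * d\<^sup>2 mod q = a" by (auto simp: Ds_def Ms_def)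
    then have "real m \<le> x / (real d)\<^sup>2" by linarith
    then have "real m * (real d)\<^sup>2 \<le> x" using r by (simp add: field_simps)
    then show ?case using p r by (auto simp: Ns_def)
  qed (auto simp: Ds_def)
  also have "\<dots> = (\<Sum>d\<in>Ds. \<Sum>m\<in>Ms d. \<mu> d)"
    by (rule sum.Sigma[symmetric]) (auto simp: Ds_def Ms_def)
  also have "\<dots> = (\<Sum>d\<in>Ds. \<mu> d * real (card (Ms d)))"
    by (simp add: mult.commute)
  also have "\<dots> = (\<Sum>d=1..<2^Suc J. if coprime d q then \<mu> d * real (card (Ms d)) else 0)"
    unfolding Ds_def by (rule sum.inter_filter) simp
  also have "\<dots> = (\<Sum>j\<le>J. \<Sum>d=2^j..<2^Suc j. if coprime d q then \<mu> d * real (card (Ms d)) else 0)"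
    by (rule sum_dyadic_blocks[symmetric])
  also have "\<dots> = (\<Sum>j\<le>J. progression_weight \<mu> (\<lambda>d. nat \<lfloor>x / (real d)\<^sup>2\<rfloor>) {d \<in> {2^j..<2^Suc j}. coprime d q} q a)"
    unfolding progression_weight_def Ms_def by (intro sum.cong refl sum.inter_filter[symmetric]) auto
  finally show ?thesis by (simp only: Ns_def \<mu>_def)
qed

text \<open>The exponent 6 is 4 from each block and 2 from the \<open>J + 1\<close> blocks, which
  count once in Cauchy-Schwarz and once in the sum.\<close>

lemma squarefree_progression_variance_le:
  fixes x :: real and q :: nat
  assumes x: "1 \<le> x" and q: "q > 0" "real q \<le> x"
  defines "S \<equiv> \<lambda>a. \<Sum>n | 1 \<le> n \<and> real n \<le> x \<and> n mod q = a. real_of_int \<bar>moebius_mu n\<bar>"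
  obtains c where "(\<Sum>a | a < q \<and> coprime a q. (S a - c)\<^sup>2)
    \<le> 256 * real (card {g. g dvd q}) * (2 + 2 * ln x) ^ 6 * (sqrt x * sqrt (real q) + x / sqrt (real q))"
proof -
  \<comment> \<open>As \<open>ln 2 \<ge> 1/2\<close>, \<open>2^n \<le> x\<close> gives
    \<open>n \<le> 2 ln x\<close>; the constant 2 leaves room for \<open>I + 1 = I0 + 2\<close> and
    for harmonic sums up to \<open>2 x\<close>.\<close>
  define L where "L = 2 + 2 * ln x"
  define V where "V = 256 * real (card {g. g dvd q}) * L ^ 4 * (sqrt x * sqrt (real q) + x / sqrt (real q))"
  have lnx: "ln x \<ge> 0" using x by simp
  have L1: "L \<ge> 1" using lnx by (simp add: L_def)
  have V0: "V \<ge> 0" using x L1 by (simp add: V_def)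
  have ln2: "1 / 2 \<le> ln (2::real)" "ln (2::real) \<le> 1"
    using ln_le_minus_one[of "1 / 2 :: real"] ln_le_minus_one[of "2 :: real"] by (simp_all add: ln_div)
  have log_le: "real n \<le> 2 * ln x" if "2 ^ n \<le> x" for n :: nat
  proof -
    have "ln ((2::real) ^ n) \<le> ln x" using that x by (subst ln_le_cancel_iff) auto
    then have "real n * ln 2 \<le> ln x" by (simp add: ln_realpow)
    moreover have "real n * (1 / 2) \<le> real n * ln 2" using ln2 by (intro mult_left_mono) auto
    ultimately show ?thesis by simp
  qed
  have har: "(\<Sum>k=1..n. 1 / real k) \<le> L" if "n > 0" "real n \<le> 2 * x" for n
  proof -
    have "ln (real n) \<le> ln (2 * x)" using that x by (subst ln_le_cancel_iff) auto
    also have "\<dots> = ln 2 + ln x" using x by (simp add: ln_mult)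
    finally show ?thesis using harmonic_sum_le[OF that(1)] ln2 lnx unfolding L_def by linarith
  qed
  obtain I0 where I0: "2 ^ I0 \<le> q" "q < 2 ^ (I0 + 1)"
    using ex_power_ivl1[of 2 q] q by auto
  define I where "I = I0 + 1"
  have I0x: "2 ^ I0 \<le> x"
  proof -
    have "real (2 ^ I0) \<le> real q" using I0 by (simp only: of_nat_le_iff)
    then have "2 ^ I0 \<le> real q" by (simp only: of_nat_power of_nat_numeral)
    then show ?thesis using q(2) by (rule order_trans)
  qed
  have I: "q \<le> 2 ^ I" "real (I + 1) \<le> L" "real (2 ^ I) \<le> 2 * x"
    using I0 I0x log_le[OF I0x] by (auto simp: I_def L_def)
  \<comment> \<open>With this J every block start \<open>2^j\<close> has square at most x. Hence N
    is at least 1, as the harmonic bound demands.\<close>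
  have "\<exists>J. 4 ^ J \<le> nat \<lfloor>x\<rfloor> \<and> nat \<lfloor>x\<rfloor> < 4 ^ (J + 1)"
    using x by (intro ex_power_ivl1) (auto simp: le_nat_floor)
  then obtain J where J: "4 ^ J \<le> nat \<lfloor>x\<rfloor>" "nat \<lfloor>x\<rfloor> < 4 ^ (J + 1)"
    by blast
  have Jx: "4 ^ J \<le> x"
  proof -
    have "real (4 ^ J) \<le> real (nat \<lfloor>x\<rfloor>)" using J by (simp only: of_nat_le_iff)
    also have "\<dots> \<le> x" using x by (intro of_nat_floor) auto
    finally show ?thesis by simp
  qed
  have xJ: "x < 4 ^ Suc J"
  proof -
    have "nat \<lfloor>x\<rfloor> + 1 \<le> 4 ^ Suc J" using J by simp
    then have "real (nat \<lfloor>x\<rfloor> + 1) \<le> real (4 ^ Suc J)" by (simp only: of_nat_le_iff)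
    moreover have "x < real (nat \<lfloor>x\<rfloor> + 1)" using x by linarith
    ultimately show ?thesis by simp
  qed
  have "(2::real) ^ J \<le> 4 ^ J" by (rule power_mono) auto
  then have JL: "real (J + 1) \<le> L" using log_le[of J] Jx by (simp add: L_def)
  define F where "F = (\<lambda>j. progression_weight (\<lambda>d. real_of_int (moebius_mu d)) (\<lambda>d. nat \<lfloor>x / (real d)\<^sup>2\<rfloor>)
                {d \<in> {2^j..<2^Suc j}. coprime d q} q)"
  define m where "m = (\<lambda>j. (\<Sum>a<q. F j a) / real q)"
  have block: "(\<Sum>a<q. (F j a - m j)\<^sup>2) \<le> V" if "j \<le> J" for j
  proof -
    define P where "P = (2::nat) ^ j"
    define N where "N = nat \<lfloor>x / (real P)\<^sup>2\<rfloor>"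
    have P: "P > 0" by (simp add: P_def)
    have "(real P)\<^sup>2 = 4 ^ j" by (simp add: P_def power_even_eq power2_eq_square flip: power_mult_distrib)
    also have "\<dots> \<le> 4 ^ J" using that by (intro power_increasing) auto
    finally have Px2: "(real P)\<^sup>2 \<le> x" using Jx by linarith
    have "real P * 1 \<le> real P * real P" using P by (intro mult_left_mono) auto
    then have Px: "real P \<le> x" using Px2 by (simp add: power2_eq_square)
    have "1 \<le> x / (real P)\<^sup>2" using Px2 P by (simp add: field_simps)
    then have N1: "N \<ge> 1" unfolding N_def by (simp add: le_nat_floor)
    have Nle: "real N \<le> x / (real P)\<^sup>2" unfolding N_def using x by (intro of_nat_floor) auto
    have NP: "real N * (real P)\<^sup>2 \<le> x" using Nle P by (simp add: field_simps)
    have "x / (real P)\<^sup>2 \<le> x / 1" using P x by (intro divide_left_mono) (auto simp: one_le_power)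
    then have Nx: "real N \<le> x" using Nle by simp
    show ?thesis
      unfolding m_def F_def V_def
    proof (rule block_variance_le[where P = P and N = N and I = I])
      show "{d \<in> {2 ^ j..<2 ^ Suc j}. coprime d q} \<subseteq> {1..2 * P}"
        using P by (auto simp: P_def intro: order_trans[rotated])
      show "\<bar>real_of_int (moebius_mu d)\<bar> \<le> 1" for d
        using abs_moebius_mu_le_1[of d] by linarith
      show "nat \<lfloor>x / (real d)\<^sup>2\<rfloor> \<le> N" if "d \<in> {d \<in> {2 ^ j..<2 ^ Suc j}. coprime d q}" for d
      proof -
        have "P \<le> d" using that by (simp add: P_def)
        then have "(real P)\<^sup>2 \<le> (real d)\<^sup>2" by (intro power_mono) auto
        then have "x / (real d)\<^sup>2 \<le> x / (real P)\<^sup>2" using P x \<open>P \<le> d\<close> by (intro divide_left_mono) auto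
        then show ?thesis unfolding N_def by (intro nat_mono floor_mono)
      qed
      show "(\<Sum>k=1..2 * P. 1 / real k) \<le> L" using P Px by (intro har) auto
      show "(\<Sum>k=1..N. 1 / real k) \<le> L" using N1 Nx x by (intro har) auto
      show "(\<Sum>k=1..2 ^ I. 1 / real k) \<le> L" using I(3) by (intro har) auto
    qed (use q P NP I L1 in auto)
  qed
  have "(\<Sum>a | a < q \<and> coprime a q. (S a - (\<Sum>j\<le>J. m j))\<^sup>2)
      = (\<Sum>a | a < q \<and> coprime a q. (\<Sum>j\<le>J. F j a - m j)\<^sup>2)"
  proof (intro sum.cong refl)
    fix a assume "a \<in> {a. a < q \<and> coprime a q}"
    then have "S a = (\<Sum>j\<le>J. F j a)"
      unfolding S_def F_def using q xJ by (intro progression_sum_abs_moebius_mu) auto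
    then show "(S a - (\<Sum>j\<le>J. m j))\<^sup>2 = (\<Sum>j\<le>J. F j a - m j)\<^sup>2" by (simp add: sum_subtractf)
  qed
  \<comment> \<open>Classes not prime to q are added at no harm, because Parseval works on all of
    Z/qZ.\<close>
  also have "\<dots> \<le> (\<Sum>a<q. (\<Sum>j\<le>J. F j a - m j)\<^sup>2)"
    by (intro sum_mono2) auto
  also have "\<dots> \<le> (\<Sum>a<q. (\<Sum>j\<le>J. (F j a - m j)\<^sup>2) * real (J + 1))"
    using sum_squared_le_sum_of_squares[of _ "{..J}"] by (intro sum_mono) simp
  also have "\<dots> = real (J + 1) * (\<Sum>j\<le>J. \<Sum>a<q. (F j a - m j)\<^sup>2)"
    unfolding sum_distrib_right[symmetric] sum.swap[of _ "{..J}"] by (rule mult.commute)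
  also have "\<dots> \<le> real (J + 1) * (\<Sum>j\<le>J. V)"
    by (intro mult_left_mono sum_mono block) auto
  also have "\<dots> = (real (J + 1))\<^sup>2 * V" by (simp add: power2_eq_square)
  also have "\<dots> \<le> L\<^sup>2 * V" using JL V0 by (intro mult_right_mono power_mono) auto
  also have "\<dots> = 256 * real (card {g. g dvd q}) * L ^ 6 * (sqrt x * sqrt (real q) + x / sqrt (real q))"
    by (simp add: V_def flip: power_add)
  finally show ?thesis unfolding L_def by (rule that)
qed

text \<open>Sorted by classes, \<open>T_gamma\<close> is the correlation of the class counts
  \<open>s\<close> with their rearrangement by \<gamma>, and the sum that is squared is the total of
  \<open>s\<close>. So 512 is twice the constant of the variance.\<close>

lemma T_gamma_variance_bound:
  fixes x :: real and q :: nat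
  assumes x: "1 \<le> x" and q: "q > 0" "real q \<le> x"
    and \<gamma>: "bij_betw \<gamma> (Units (ZFact (int q))) (Units (ZFact (int q)))"
  shows "\<bar>T_gamma \<gamma> x q - 1 / real (totient q) *
            (\<Sum>n | 1 \<le> n \<and> real n \<le> x \<and> gcd n q = 1. real_of_int \<bar>moebius_mu n\<bar>)\<^sup>2\<bar>
    \<le> 512 * real (card {g. g dvd q}) * (2 + 2 * ln x) ^ 6 * (sqrt x * sqrt (real q) + x / sqrt (real q))"
proof -
  define U where "U = Units (ZFact (int q))"
  define z where "z = (\<lambda>n. ZMod (int q) (int n))"
  define Ns where "Ns = {n::nat. 1 \<le> n \<and> real n \<le> x \<and> coprime n q}"
  define \<nu> where "\<nu> = (\<lambda>n. real_of_int \<bar>moebius_mu n\<bar>)"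
  define s where "s = (\<lambda>A. \<Sum>n | n \<in> Ns \<and> z n = A. \<nu> n)"
  note bij = bij_betw_ZMod_Units[OF q(1), folded z_def U_def]
  have cardU: "card U = totient q" unfolding U_def by (rule card_Units_ZFact[OF q(1)])
  have finU: "finite U" using bij_betw_finite[OF bij] by simp
  have finN: "finite Ns" by (rule finite_subset[of _ "{..nat \<lfloor>x\<rfloor>}"]) (auto simp: Ns_def le_nat_floor)
  have zU: "z n \<in> U" if "n \<in> Ns" for n
    using that unfolding z_def U_def Ns_def by (simp add: ZMod_in_Units_ZFact_iff)
  have M: "(\<Sum>n\<in>Ns. \<nu> n) = (\<Sum>A\<in>U. s A)"
    unfolding s_def using finN finU zU by (intro sum.group[symmetric]) auto
  have "T_gamma \<gamma> x q = (\<Sum>(n1, n2)\<in>{(n1, n2). n2 \<in> Ns \<and> n1 \<in> Ns \<and> z n1 = \<gamma> (z n2)}. \<nu> n1 * \<nu> n2)"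
    unfolding T_gamma_def
  proof (intro sum.cong)
    show "{(n1, n2). 1 \<le> n1 \<and> real n1 \<le> x \<and> 1 \<le> n2 \<and> real n2 \<le> x \<and> gcd (n1 * n2) q = 1 \<and>
            ZMod (int q) (int n1) = \<gamma> (ZMod (int q) (int n2))}
        = {(n1, n2). n2 \<in> Ns \<and> n1 \<in> Ns \<and> z n1 = \<gamma> (z n2)}"
      unfolding coprime_iff_gcd_eq_1[symmetric] by (auto simp: Ns_def z_def)
  qed (auto simp: \<nu>_def)
  also have "\<dots> = (\<Sum>(n2, n1)\<in>(SIGMA n2:Ns. {n1. n1 \<in> Ns \<and> z n1 = \<gamma> (z n2)}). \<nu> n1 * \<nu> n2)"
    by (rule sum.reindex_bij_witness[where i = prod.swap and j = prod.swap]) auto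
  also have "\<dots> = (\<Sum>n2\<in>Ns. \<Sum>n1 | n1 \<in> Ns \<and> z n1 = \<gamma> (z n2). \<nu> n1 * \<nu> n2)"
    using finN by (intro sum.Sigma[symmetric]) auto
  also have "\<dots> = (\<Sum>n2\<in>Ns. s (\<gamma> (z n2)) * \<nu> n2)"
    by (simp add: s_def sum_distrib_right)
  also have "\<dots> = (\<Sum>A\<in>U. \<Sum>n2 | n2 \<in> Ns \<and> z n2 = A. s (\<gamma> (z n2)) * \<nu> n2)"
    using finN finU zU by (intro sum.group[symmetric]) auto
  also have "\<dots> = (\<Sum>A\<in>U. s (\<gamma> A) * s A)"
    by (intro sum.cong refl) (simp add: s_def sum_distrib_left)
  finally have T: "T_gamma \<gamma> x q = (\<Sum>A\<in>U. s (\<gamma> A) * s A)" .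
  obtain c where c: "(\<Sum>a | a < q \<and> coprime a q.
      ((\<Sum>n | 1 \<le> n \<and> real n \<le> x \<and> n mod q = a. real_of_int \<bar>moebius_mu n\<bar>) - c)\<^sup>2)
      \<le> 256 * real (card {g. g dvd q}) * (2 + 2 * ln x) ^ 6 * (sqrt x * sqrt (real q) + x / sqrt (real q))"
    using squarefree_progression_variance_le[OF x q] by blast
  have "(\<Sum>A\<in>U. (s A - c)\<^sup>2) = (\<Sum>a | a < q \<and> coprime a q. (s (z a) - c)\<^sup>2)"
    by (rule sum.reindex_bij_betw[OF bij, symmetric])
  also have "\<dots> = (\<Sum>a | a < q \<and> coprime a q.
      ((\<Sum>n | 1 \<le> n \<and> real n \<le> x \<and> n mod q = a. real_of_int \<bar>moebius_mu n\<bar>) - c)\<^sup>2)"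
  proof (intro sum.cong refl)
    fix a assume a: "a \<in> {a. a < q \<and> coprime a q}"
    have "{n. n \<in> Ns \<and> z n = z a} = {n. 1 \<le> n \<and> real n \<le> x \<and> n mod q = a}"
    proof -
      have "z n = z a \<longleftrightarrow> n mod q = a" for n
        using a by (simp add: z_def ZMod_eq_mod flip: of_nat_mod)
      moreover have "coprime n q" if "n mod q = a" for n
      proof -
        have "coprime (n mod q) q" using a that by simp
        then show ?thesis using q by simp
      qed
      ultimately show ?thesis by (auto simp: Ns_def)
    qed
    then show "(s (z a) - c)\<^sup>2 = ((\<Sum>n | 1 \<le> n \<and> real n \<le> x \<and> n mod q = a. real_of_int \<bar>moebius_mu n\<bar>) - c)\<^sup>2"
      by (simp only: s_def \<nu>_def)
  qed
  finally have "(\<Sum>A\<in>U. (s A - c)\<^sup>2)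
      \<le> 256 * real (card {g. g dvd q}) * (2 + 2 * ln x) ^ 6 * (sqrt x * sqrt (real q) + x / sqrt (real q))"
    using c by (simp only:)
  moreover have "\<bar>(\<Sum>A\<in>U. s (\<gamma> A) * s A) - (\<Sum>A\<in>U. s A)\<^sup>2 / real (card U)\<bar> \<le> 2 * (\<Sum>A\<in>U. (s A - c)\<^sup>2)"
    by (rule correlation_le_variance[OF finU \<gamma>[folded U_def]])
  ultimately have "\<bar>(\<Sum>A\<in>U. s (\<gamma> A) * s A) - (\<Sum>A\<in>U. s A)\<^sup>2 / real (card U)\<bar>
      \<le> 512 * real (card {g. g dvd q}) * (2 + 2 * ln x) ^ 6 * (sqrt x * sqrt (real q) + x / sqrt (real q))"
    by linarith
  moreover have "(\<Sum>n | 1 \<le> n \<and> real n \<le> x \<and> gcd n q = 1. real_of_int \<bar>moebius_mu n\<bar>) = (\<Sum>A\<in>U. s A)"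
    unfolding coprime_iff_gcd_eq_1[symmetric] using M by (simp only: Ns_def \<nu>_def)
  ultimately show ?thesis unfolding T cardU by (simp only: mult_1 times_divide_eq_left)
qed

theorem corollary6:
  fixes \<epsilon> :: real
  assumes "\<epsilon> > 0"
  shows "\<exists>C>0. \<forall>(x::real) (q::nat) (\<gamma> :: int set \<Rightarrow> int set).
           x \<ge> 1 \<longrightarrow> q \<ge> 1 \<longrightarrow> real q \<le> x \<longrightarrow>
           bij_betw \<gamma> (Units (ZFact (int q))) (Units (ZFact (int q))) \<longrightarrow>
           \<bar>T_gamma \<gamma> x q -
              1 / real (totient q) *
              (\<Sum>n | 1 \<le> n \<and> real n \<le> x \<and> gcd n q = 1. real_of_int \<bar>moebius_mu n\<bar>)\<^sup>2\<bar>
           \<le> C * (x powr \<epsilon> *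
                   (x powr (1/2) * real q powr (1/2) + x / real q powr (1/2)))"
proof -
  \<comment> \<open>Half of \<epsilon> goes to the divisor function. The sixth power of the
    logarithm gets the other half, so each factor may cost
    \<open>x powr (\<epsilon> / 12)\<close>.\<close>
  define \<delta> where "\<delta> = \<epsilon> / 12"
  have \<delta>: "\<delta> > 0" using assms by (simp add: \<delta>_def)
  obtain C0 where C0: "C0 > 0" "\<And>n. n > 0 \<Longrightarrow> real (card {d. d dvd n}) \<le> C0 * real n powr (\<epsilon> / 2)"
    using card_divisors_le_powr[of "\<epsilon> / 2"] assms by auto
  define C1 where "C1 = 2 + 2 / \<delta>"
  have C1: "C1 > 0" using \<delta> by (simp add: C1_def add_pos_pos)
  define C where "C = 512 * C0 * C1 ^ 6"
  have "C > 0" using C0 C1 by (simp add: C_def)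
  moreover have "\<bar>T_gamma \<gamma> x q - 1 / real (totient q) *
            (\<Sum>n | 1 \<le> n \<and> real n \<le> x \<and> gcd n q = 1. real_of_int \<bar>moebius_mu n\<bar>)\<^sup>2\<bar>
      \<le> C * (x powr \<epsilon> * (x powr (1/2) * real q powr (1/2) + x / real q powr (1/2)))"
    if x: "x \<ge> 1" and q: "q \<ge> 1" "real q \<le> x"
      and \<gamma>: "bij_betw \<gamma> (Units (ZFact (int q))) (Units (ZFact (int q)))"
    for x :: real and q :: nat and \<gamma> :: "int set \<Rightarrow> int set"
  proof -
    define E where "E = sqrt x * sqrt (real q) + x / sqrt (real q)"
    have E0: "E \<ge> 0" using x by (simp add: E_def)
    have "real (card {g. g dvd q}) \<le> C0 * real q powr (\<epsilon> / 2)" using C0(2)[of q] q by simp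
    also have "\<dots> \<le> C0 * x powr (\<epsilon> / 2)"
      using C0(1) q assms by (intro mult_left_mono powr_mono2) auto
    finally have 1: "real (card {g. g dvd q}) \<le> C0 * x powr (\<epsilon> / 2)" .
    have "1 \<le> x powr \<delta>" using x \<delta> by (simp add: ge_one_powr_ge_zero)
    moreover have "ln x \<le> x powr \<delta> / \<delta>" using x \<delta> by (rule ln_powr_bound)
    ultimately have "2 + 2 * ln x \<le> C1 * x powr \<delta>" by (simp add: C1_def algebra_simps)
    then have "(2 + 2 * ln x) ^ 6 \<le> (C1 * x powr \<delta>) ^ 6" using x by (intro power_mono) auto
    also have "\<dots> = C1 ^ 6 * x powr (\<epsilon> / 2)"
      using x by (simp add: power_mult_distrib \<delta>_def powr_powr flip: powr_realpow)
    finally have 2: "(2 + 2 * ln x) ^ 6 \<le> C1 ^ 6 * x powr (\<epsilon> / 2)" .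
    have "512 * real (card {g. g dvd q}) * (2 + 2 * ln x) ^ 6 * E
        \<le> 512 * (C0 * x powr (\<epsilon> / 2)) * (C1 ^ 6 * x powr (\<epsilon> / 2)) * E"
      using 1 2 E0 x C0 C1 by (intro mult_right_mono mult_mono mult_left_mono) auto
    also have "\<dots> = C * (x powr (\<epsilon> / 2) * x powr (\<epsilon> / 2) * E)" by (simp add: C_def mult_ac)
    also have "x powr (\<epsilon> / 2) * x powr (\<epsilon> / 2) = x powr \<epsilon>" by (simp flip: powr_add)
    finally have 3: "512 * real (card {g. g dvd q}) * (2 + 2 * ln x) ^ 6 * E \<le> C * (x powr \<epsilon> * E)" .
    have "\<bar>T_gamma \<gamma> x q - 1 / real (totient q) *
            (\<Sum>n | 1 \<le> n \<and> real n \<le> x \<and> gcd n q = 1. real_of_int \<bar>moebius_mu n\<bar>)\<^sup>2\<bar>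
        \<le> 512 * real (card {g. g dvd q}) * (2 + 2 * ln x) ^ 6 * E"
      unfolding E_def using q by (intro T_gamma_variance_bound[OF x _ _ \<gamma>]) auto
    also note 3
    also have "E = x powr (1/2) * real q powr (1/2) + x / real q powr (1/2)"
      using x by (simp add: E_def powr_half_sqrt)
    finally show ?thesis .
  qed
  ultimately show ?thesis by blast
qed

end
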